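(* Let $M$ be a polynomial group (of degree at most $k$) over a field $\mathbb{K}$ of characteristic zero. Denote by $\mathfrak{m}$ a copy of the $\mathbb{K}$-vector space $M$. Then there exists a unique polynomial map $\exp:\mathfrak{m}\to M$ such that (1) for all $X\in\mathfrak{m}$ and $n\in\mathbb{Z}$, $\exp(nX)=(\exp X)^n$; (2) the linear term of $\exp$ is the identity map $\mathfrak{m}=M$. The polynomial $\exp$ is bijective, and its inverse map $\log:M\to\mathfrak{m}$ is again polynomial. One has the explicit formulae $$\exp(x)=\sum_{p=1}^k\frac1{p!}\,\psi_{p,p}(x),\qquad \log(x)=\sum_{p=1}^k\frac{(-1)^{p-1}}{p}\,\psi_p(x),$$ where $\psi_{p,m}$ is the homogeneous component of degree $m$ of $\psi_p$.
   Context: A polynomial map between $\mathbb{K}$-vector spaces is a finite sum $p=\sum_ip_i$ of homogeneous polynomial maps $p_i(x)=b_i(x,\dots,x)$, with $b_i$ an $i$-multilinear map; since $\mathbb{K}$ is infinite, the (multi)homogeneous components are determined by $p$. A polynomial group (over $\mathbb{K}$) of degree at most $k$ ($k\in\mathbb{N}$) is a $\mathbb{K}$-vector space $M$ with a group structure with neutral element $e=0$ such that the product $m:M\times M\to M$ and the inversion are polynomial, and all iterated product maps $m^{(j)}:M^j\to M$, $(x_1,\dots,x_j)\mapsto x_1\cdots x_j$, $j\in\mathbb{N}$, are polynomial maps of degree bounded by $k$. Let $m^{(j)}=\sum_{p_1,\dots,p_j\ge0}m^{(j)}_{p_1,\dots,p_j}$ be the decomposition into multihomogeneous parts ($m^{(j)}_{p_1,\dots,p_j}$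 being homogeneous of degree $p_i$ in $x_i$). Then $\psi_j:M\to M$ is defined by $\psi_j(x)=\sum_{p_1,\dots,p_j>0}m^{(j)}_{p_1,\dots,p_j}(x,\dots,x)$. *)

theory Defs
  imports
    Complex_Main
    "HOL-Algebra.Group"
    "HOL-Library.Function_Algebras"
    "HOL-Library.Product_Plus"
begin

text \<open>
  Polynomial maps are defined on a linear subspace \<open>V\<close> of a type, because the power \<open>M\<^sup>j\<close> with
  varying \<open>j\<close> is realised as a subspace of \<open>nat \<Rightarrow> 'm\<close>. The arguments \<open>sV\<close> and \<open>sW\<close> are the scalar
  multiplications of domain and codomain. An \<open>i\<close>-multilinear map takes its arguments as a list of
  length \<open>i\<close>; its values on all other lists are irrelevant.
\<close>

definition multilinear_map ::
  "('k::field \<Rightarrow> 'v::ab_group_add \<Rightarrow> 'v) \<Rightarrow> ('k \<Rightarrow> 'w::ab_group_add \<Rightarrow> 'w) \<Rightarrow> 'v set \<Rightarrow>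
    nat \<Rightarrow> ('v list \<Rightarrow> 'w) \<Rightarrow> bool" where
  "multilinear_map sV sW V i b \<longleftrightarrow>
    (\<forall>xs l. length xs = i \<longrightarrow> set xs \<subseteq> V \<longrightarrow> l < i \<longrightarrow>
      (\<forall>u\<in>V. \<forall>v\<in>V. b (xs[l := u + v]) = b (xs[l := u]) + b (xs[l := v])) \<and>
      (\<forall>c. \<forall>u\<in>V. b (xs[l := sV c u]) = sW c (b (xs[l := u]))))"

definition homogeneous_map ::
  "('k::field \<Rightarrow> 'v::ab_group_add \<Rightarrow> 'v) \<Rightarrow> ('k \<Rightarrow> 'w::ab_group_add \<Rightarrow> 'w) \<Rightarrow> 'v set \<Rightarrow>
    nat \<Rightarrow> ('v \<Rightarrow> 'w) \<Rightarrow> bool" where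
  "homogeneous_map sV sW V i f \<longleftrightarrow>
    (\<exists>b. multilinear_map sV sW V i b \<and> (\<forall>x\<in>V. f x = b (replicate i x)))"

definition polynomial_map_le ::
  "('k::field \<Rightarrow> 'v::ab_group_add \<Rightarrow> 'v) \<Rightarrow> ('k \<Rightarrow> 'w::ab_group_add \<Rightarrow> 'w) \<Rightarrow> 'v set \<Rightarrow>
    nat \<Rightarrow> ('v \<Rightarrow> 'w) \<Rightarrow> bool" where
  "polynomial_map_le sV sW V d f \<longleftrightarrow>
    (\<exists>q. (\<forall>i\<le>d. homogeneous_map sV sW V i (q i)) \<and> (\<forall>x\<in>V. f x = (\<Sum>i\<le>d. q i x)))"

definition polynomial_map ::
  "('k::field \<Rightarrow> 'v::ab_group_add \<Rightarrow> 'v) \<Rightarrow> ('k \<Rightarrow> 'w::ab_group_add \<Rightarrow> 'w) \<Rightarrow> 'v set \<Rightarrow>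
    ('v \<Rightarrow> 'w) \<Rightarrow> bool" where
  "polynomial_map sV sW V f \<longleftrightarrow> (\<exists>d. polynomial_map_le sV sW V d f)"

text \<open>
  Over an infinite field the homogeneous components of a polynomial map are uniquely determined;
  the following description is meaningful only for polynomial maps over such fields.
\<close>

definition homogeneous_component ::
  "('k::field \<Rightarrow> 'v::ab_group_add \<Rightarrow> 'v) \<Rightarrow> ('k \<Rightarrow> 'w::ab_group_add \<Rightarrow> 'w) \<Rightarrow>
    ('v \<Rightarrow> 'w) \<Rightarrow> nat \<Rightarrow> 'v \<Rightarrow> 'w" where
  "homogeneous_component sV sW f =
    (THE q. (\<forall>i. homogeneous_map sV sW UNIV i (q i)) \<and> finite {i. q i \<noteq> (\<lambda>_. 0)} \<and>
      (\<forall>x. f x = (\<Sum>i | q i \<noteq> (\<lambda>_. 0). q i x)))"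

definition power_space :: "nat \<Rightarrow> (nat \<Rightarrow> 'm::zero) set" where
  "power_space j = {x. \<forall>i\<ge>j. x i = 0}"

definition power_scale :: "('k \<Rightarrow> 'm \<Rightarrow> 'm) \<Rightarrow> 'k \<Rightarrow> (nat \<Rightarrow> 'm) \<Rightarrow> (nat \<Rightarrow> 'm)" where
  "power_scale s c x = (\<lambda>i. s c (x i))"

definition diagonal :: "nat \<Rightarrow> 'm::zero \<Rightarrow> nat \<Rightarrow> 'm" where
  "diagonal j x = (\<lambda>i. if i < j then x else 0)"

text \<open>The multidegree \<open>(p\<^sub>1, \<dots>, p\<^sub>j)\<close> is a list of length \<open>j\<close>.\<close>

definition multihomogeneous_map ::
  "('k::field \<Rightarrow> 'm::ab_group_add \<Rightarrow> 'm) \<Rightarrow> nat list \<Rightarrow> ((nat \<Rightarrow> 'm) \<Rightarrow> 'm) \<Rightarrow> bool" where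
  "multihomogeneous_map s p f \<longleftrightarrow>
    polynomial_map (power_scale s) s (power_space (length p)) f \<and>
    (\<forall>i<length p. \<forall>x\<in>power_space (length p).
      homogeneous_map s s UNIV (p ! i) (\<lambda>y. f (x(i := y))))"

text \<open>
  As for \<^const>\<open>homogeneous_component\<close>. The components are set to zero outside \<open>M\<^sup>j\<close> and for
  lists of length different from \<open>j\<close>, so that the family is unique as a function.
\<close>

definition multihomogeneous_component ::
  "('k::field \<Rightarrow> 'm::ab_group_add \<Rightarrow> 'm) \<Rightarrow> nat \<Rightarrow> ((nat \<Rightarrow> 'm) \<Rightarrow> 'm) \<Rightarrow>
    nat list \<Rightarrow> (nat \<Rightarrow> 'm) \<Rightarrow> 'm" where
  "multihomogeneous_component s j f =
    (THE q. (\<forall>p. length p = j \<longrightarrow> multihomogeneous_map s p (q p)) \<and>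
      (\<forall>p x. length p \<noteq> j \<or> x \<notin> power_space j \<longrightarrow> q p x = 0) \<and>
      finite {p. q p \<noteq> (\<lambda>_. 0)} \<and>
      (\<forall>x\<in>power_space j. f x = (\<Sum>p | q p \<noteq> (\<lambda>_. 0). q p x)))"

definition iterated_product :: "'m monoid \<Rightarrow> nat \<Rightarrow> (nat \<Rightarrow> 'm) \<Rightarrow> 'm" where
  "iterated_product G j x = foldr (\<otimes>\<^bsub>G\<^esub>) (map x [0..<j]) \<one>\<^bsub>G\<^esub>"

locale polynomial_group = vector_space scale + group G
  for scale :: "'k::field \<Rightarrow> 'm::ab_group_add \<Rightarrow> 'm"
    and G :: "'m monoid" (structure)
    and k :: nat +
  assumes carrier_eq: "carrier G = UNIV"
    and one_eq: "\<one> = 0"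
    and mult_polynomial:
      "polynomial_map (\<lambda>c (x, y). (scale c x, scale c y)) scale UNIV (\<lambda>(x, y). x \<otimes> y)"
    and inv_polynomial: "polynomial_map scale scale UNIV (\<lambda>x. inv\<^bsub>G\<^esub> x)"
    and iterated_product_polynomial:
      "\<And>j. polynomial_map_le (power_scale scale) scale (power_space j) k (iterated_product G j)"

definition psi :: "('k::field \<Rightarrow> 'm::ab_group_add \<Rightarrow> 'm) \<Rightarrow> 'm monoid \<Rightarrow> nat \<Rightarrow> 'm \<Rightarrow> 'm" where
  "psi s G j x =
    (let q = multihomogeneous_component s j (iterated_product G j)
     in \<Sum>p | length p = j \<and> (\<forall>i<j. p ! i > 0) \<and> q p \<noteq> (\<lambda>_. 0). q p (diagonal j x))"

definition psi_component ::
  "('k::field \<Rightarrow> 'm::ab_group_add \<Rightarrow> 'm) \<Rightarrow> 'm monoid \<Rightarrow> nat \<Rightarrow> nat \<Rightarrow> 'm \<Rightarrow> 'm" where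
  "psi_component s G p m = homogeneous_component s s (psi s G p) m"

definition is_group_exponential ::
  "('k::field \<Rightarrow> 'm::ab_group_add \<Rightarrow> 'm) \<Rightarrow> 'm monoid \<Rightarrow> ('m \<Rightarrow> 'm) \<Rightarrow> bool" where
  "is_group_exponential s G e \<longleftrightarrow>
    polynomial_map s s UNIV e \<and>
    (\<forall>X (n::int). e (s (of_int n) X) = e X [^]\<^bsub>G\<^esub> n) \<and>
    homogeneous_component s s e 1 = id"

end

theory Submission
  imports Defs "HOL-Computational_Algebra.Polynomial"
begin

text \<open>
  The powers of a group element \<open>x\<close> determine everything. Setting some arguments of an iterated
  product to \<open>0 = e\<close> kills exactly the multihomogeneous parts that involve those arguments, so
  \<open>\<psi>\<^sub>p(x)\<close> is the \<open>p\<close>-th finite difference at \<open>0\<close> of \<open>n \<mapsto> x\<^sup>n\<close> (\<open>psi_eq_difference\<close>), and Newton's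
  formula gives \<open>x\<^sup>n = \<Sum>\<^sub>p (n choose p) \<psi>\<^sub>p(x)\<close>. This sum stops at \<open>p = k\<close>, because \<open>\<psi>\<^sub>p\<close> has degree at
  most \<open>k\<close> while all its components have degree at least \<open>p\<close> (\<open>psi_component_below\<close>). The right-hand
  side makes sense for every exponent \<open>t\<close> in the field and is polynomial in \<open>t\<close>. An identity between
  polynomial curves that holds at infinitely many parameters holds everywhere (\<open>poly_curve_eq\<close>), so
  the laws \<open>x\<^sup>s\<^sup>+\<^sup>t = x\<^sup>s x\<^sup>t\<close> and \<open>(x\<^sup>s)\<^sup>t = x\<^sup>s\<^sup>t\<close> extend from natural numbers to all scalars.

  The exponential is the limit of \<open>(\<epsilon> y)\<^bsup>t/\<epsilon>\<^esup>\<close> as \<open>\<epsilon>\<close> tends to \<open>0\<close>. No topology is involved: the order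
  condition on \<open>\<psi>\<^sub>p\<close> makes this expression polynomial in \<open>\<epsilon>\<close> (\<open>rescaled_power\<close>), its value at \<open>\<epsilon> = 0\<close>
  is \<open>exp(t y) = \<Sum>\<^sub>p t\<^sup>p/p! \<psi>\<^sub>p\<^sub>,\<^sub>p(y)\<close>, and identities valid for \<open>\<epsilon> \<noteq> 0\<close> persist at \<open>\<epsilon> = 0\<close>. The additivity
  of \<open>t \<mapsto> exp(t y)\<close> arises in this way. The logarithm is the derivative at \<open>t = 0\<close> of \<open>t \<mapsto> x\<^sup>t\<close>.
  Writing \<open>x\<^sup>\<epsilon> = \<epsilon> L(\<epsilon>)\<close> with \<open>L(0) = log x\<close>, the identity \<open>x = (x\<^sup>\<epsilon>)\<^bsup>1/\<epsilon>\<^esup> = (\<epsilon> L(\<epsilon>))\<^bsup>1/\<epsilon>\<^esup>\<close> becomes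
  \<open>x = exp(log x)\<close> at \<open>\<epsilon> = 0\<close> (\<open>exponential_logarithm\<close>). Conversely, any map \<open>e\<close> with the two defining
  properties satisfies \<open>e(t X) = e(X)\<^sup>t\<close> for all scalars \<open>t\<close>, and comparing the terms linear in \<open>t\<close>
  yields \<open>X = log(e(X))\<close> (\<open>logarithm_group_exponential\<close>). Hence \<open>e = exp \<circ> log \<circ> e = exp\<close>, which is
  uniqueness, and \<open>log\<close> is a two-sided inverse.
\<close>

section \<open>Polynomial curves in a vector space\<close>

lemma infinite_naturals: "infinite (range of_nat :: 'a::semiring_char_0 set)"
  by (rule range_inj_infinite) (simp add: inj_on_def)

text \<open>
  A nonzero vector coefficient is detected by some linear functional, which reduces the claim to the
  finiteness of the zero set of a nonzero polynomial with coefficients in the field.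
\<close>

lemma (in vector_space) vector_poly_coeffs_zero:
  assumes "infinite S" and zero: "\<And>t. t \<in> S \<Longrightarrow> (\<Sum>i\<le>d. scale (t ^ i) (c i)) = 0" and "i \<le> d"
  shows "c i = 0"
proof (rule ccontr)
  assume "c i \<noteq> 0"
  interpret dual: vector_space_pair scale "(*)"
    by unfold_locales (simp_all add: algebra_simps)
  have "independent {c i}" using \<open>c i \<noteq> 0\<close> by simp
  from dual.linear_independent_extend[OF this, of "\<lambda>_. 1"]
  obtain \<phi> where lin: "Vector_Spaces.linear scale (*) \<phi>" and \<phi>: "\<phi> (c i) = 1" by auto
  define P where "P = (\<Sum>l\<le>d. monom (\<phi> (c l)) l)"
  have "poly P t = 0" if "t \<in> S" for t
  proof -
    have "poly P t = (\<Sum>l\<le>d. \<phi> (scale (t ^ l) (c l)))"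
      using lin by (simp add: P_def poly_sum poly_monom dual.linear_scale mult.commute)
    also have "\<dots> = \<phi> (\<Sum>l\<le>d. scale (t ^ l) (c l))"
      using lin by (simp add: dual.linear_sum)
    finally show ?thesis using zero[OF that] lin by (simp add: dual.linear_0)
  qed
  then have "S \<subseteq> {t. poly P t = 0}" by auto
  then have "P = 0" using \<open>infinite S\<close> poly_roots_finite finite_subset by blast
  moreover have "coeff P i = \<phi> (c i)"
    using \<open>i \<le> d\<close> by (simp add: P_def coeff_sum sum.delta)
  ultimately show False using \<phi> by simp
qed

text \<open>
  All polynomial identities in several variables are proved below one variable at a time, so that
  only polynomials in one scalar variable with vector coefficients are needed.
\<close>

definition poly_curve :: "('k::field \<Rightarrow> 'v::ab_group_add \<Rightarrow> 'v) \<Rightarrow> 'v set \<Rightarrow> ('k \<Rightarrow> 'v) \<Rightarrow> bool" where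
  "poly_curve s V \<gamma> \<longleftrightarrow> (\<exists>d c. (\<forall>i. c i \<in> V) \<and> (\<forall>t. \<gamma> t = (\<Sum>i\<le>d. s (t ^ i) (c i))))"

context vector_space
begin

text \<open>
  The identity principle. It serves both to extend laws from natural numbers to all scalars and to
  take the value at \<open>0\<close> of an identity known for nonzero scalars.
\<close>

lemma poly_curve_eq:
  assumes "poly_curve scale V \<gamma>" "poly_curve scale W \<delta>"
    and "infinite S" and eq: "\<And>t. t \<in> S \<Longrightarrow> \<gamma> t = \<delta> t"
  shows "\<gamma> t = \<delta> t"
proof -
  from assms obtain d c d' c' where
    \<gamma>: "\<And>t. \<gamma> t = (\<Sum>i\<le>d. scale (t ^ i) (c i))" and \<delta>: "\<And>t. \<delta> t = (\<Sum>i\<le>d'. scale (t ^ i) (c' i))"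
    unfolding poly_curve_def by blast
  define D where "D = max d d'"
  define e where "e i = (if i \<le> d then c i else 0) - (if i \<le> d' then c' i else 0)" for i
  have diff: "\<gamma> t - \<delta> t = (\<Sum>i\<le>D. scale (t ^ i) (e i))" for t
  proof -
    have "\<gamma> t = (\<Sum>i\<le>D. scale (t ^ i) (if i \<le> d then c i else 0))"
      unfolding \<gamma> by (rule sum.mono_neutral_cong_left) (auto simp: D_def)
    moreover have "\<delta> t = (\<Sum>i\<le>D. scale (t ^ i) (if i \<le> d' then c' i else 0))"
      unfolding \<delta> by (rule sum.mono_neutral_cong_left) (auto simp: D_def)
    ultimately show ?thesis by (simp add: e_def scale_right_diff_distrib sum_subtractf)
  qed
  have "e i = 0" if "i \<le> D" for i
    using assms(3) _ that
  proof (rule vector_poly_coeffs_zero)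
    show "(\<Sum>i\<le>D. scale (t ^ i) (e i)) = 0" if "t \<in> S" for t
      using diff[of t] eq[OF that] by simp
  qed
  then show ?thesis using diff[of t] by simp
qed

lemma poly_curve_monom:
  assumes "subspace V" "v \<in> V"
  shows "poly_curve scale V (\<lambda>t. scale (t ^ n) v)"
  unfolding poly_curve_def
proof (intro exI conjI allI)
  fix t
  have "(\<Sum>i\<le>n. scale (t ^ i) (if i = n then v else 0))
      = (\<Sum>i\<le>n. if i = n then scale (t ^ i) v else 0)"
    by (rule sum.cong) auto
  then show "scale (t ^ n) v = (\<Sum>i\<le>n. scale (t ^ i) (if i = n then v else 0))"
    by (simp add: sum.delta)
qed (use assms in \<open>auto simp: subspace_0\<close>)

lemma poly_curve_const: "subspace V \<Longrightarrow> v \<in> V \<Longrightarrow> poly_curve scale V (\<lambda>t. v)"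
  using poly_curve_monom[of V v 0] by simp

lemma poly_curve_add:
  assumes V: "subspace V" and "poly_curve scale V \<gamma>" "poly_curve scale V \<delta>"
  shows "poly_curve scale V (\<lambda>t. \<gamma> t + \<delta> t)"
proof -
  from assms obtain d c d' c' where c: "\<And>i. c i \<in> V" "\<And>i. c' i \<in> V" and
    \<gamma>: "\<And>t. \<gamma> t = (\<Sum>i\<le>d. scale (t ^ i) (c i))" and \<delta>: "\<And>t. \<delta> t = (\<Sum>i\<le>d'. scale (t ^ i) (c' i))"
    unfolding poly_curve_def by blast
  define D where "D = max d d'"
  define e where "e i = (if i \<le> d then c i else 0) + (if i \<le> d' then c' i else 0)" for i
  have "\<gamma> t + \<delta> t = (\<Sum>i\<le>D. scale (t ^ i) (e i))" for t
  proof -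
    have "\<gamma> t = (\<Sum>i\<le>D. scale (t ^ i) (if i \<le> d then c i else 0))"
      unfolding \<gamma> by (rule sum.mono_neutral_cong_left) (auto simp: D_def)
    moreover have "\<delta> t = (\<Sum>i\<le>D. scale (t ^ i) (if i \<le> d' then c' i else 0))"
      unfolding \<delta> by (rule sum.mono_neutral_cong_left) (auto simp: D_def)
    ultimately show ?thesis by (simp add: e_def scale_right_distrib sum.distrib)
  qed
  moreover have "e i \<in> V" for i using V c by (auto simp: e_def subspace_add subspace_0)
  ultimately show ?thesis unfolding poly_curve_def by blast
qed

lemma poly_curve_sum:
  assumes "subspace V" "\<And>a. a \<in> A \<Longrightarrow> poly_curve scale V (\<gamma> a)"
  shows "poly_curve scale V (\<lambda>t. \<Sum>a\<in>A. \<gamma> a t)"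
  using assms(2)
proof (induction A rule: infinite_finite_induct)
  case (insert a A)
  then show ?case using assms(1) by (simp add: poly_curve_add)
qed (use assms(1) in \<open>simp_all add: poly_curve_const subspace_0\<close>)

lemma poly_curve_scale:
  assumes V: "subspace V" and "poly_curve scale V \<gamma>" and f: "\<And>t. f t = poly P t"
  shows "poly_curve scale V (\<lambda>t. scale (f t) (\<gamma> t))"
proof -
  from assms obtain d c where c: "\<And>i. c i \<in> V" and
    \<gamma>: "\<And>t. \<gamma> t = (\<Sum>i\<le>d. scale (t ^ i) (c i))"
    unfolding poly_curve_def by blast
  have "scale (f t) (\<gamma> t)
      = (\<Sum>i\<le>d. \<Sum>l\<le>degree P. scale (t ^ (l + i)) (scale (coeff P l) (c i)))" for t
    by (simp add: f \<gamma> poly_altdef scale_sum_right scale_sum_left sum_distrib_left power_add mult_ac)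
  moreover have "poly_curve scale V
      (\<lambda>t. \<Sum>i\<le>d. \<Sum>l\<le>degree P. scale (t ^ (l + i)) (scale (coeff P l) (c i)))"
    using V c by (intro poly_curve_sum poly_curve_monom) (auto intro: subspace_scale)
  ultimately show ?thesis by simp
qed

lemma poly_curve_reparam:
  assumes V: "subspace V" and "poly_curve scale V \<gamma>"
  shows "poly_curve scale V (\<lambda>t. \<gamma> (a + b * t))"
proof -
  from assms obtain d c where c: "\<And>i. c i \<in> V" and "\<And>t. \<gamma> t = (\<Sum>i\<le>d. scale (t ^ i) (c i))"
    unfolding poly_curve_def by blast
  moreover have "poly_curve scale V (\<lambda>t. \<Sum>i\<le>d. scale ((a + b * t) ^ i) (c i))"
    by (intro poly_curve_sum poly_curve_scale[where P = "[:a, b:] ^ i" for i] poly_curve_const)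
      (use V c in \<open>auto simp: mult.commute\<close>)
  ultimately show ?thesis by simp
qed

end

section \<open>Multilinear, homogeneous and polynomial maps\<close>

definition linear_into ::
  "('k \<Rightarrow> 'u::ab_group_add \<Rightarrow> 'u) \<Rightarrow> ('k \<Rightarrow> 'v::ab_group_add \<Rightarrow> 'v) \<Rightarrow> 'u set \<Rightarrow> 'v set \<Rightarrow>
    ('u \<Rightarrow> 'v) \<Rightarrow> bool" where
  "linear_into sU sV U V L \<longleftrightarrow> (\<forall>u\<in>U. L u \<in> V) \<and> (\<forall>u\<in>U. \<forall>v\<in>U. L (u + v) = L u + L v) \<and>
    (\<forall>c. \<forall>u\<in>U. L (sU c u) = sV c (L u))"

text \<open>
  A list of slots, each either frozen to a vector (\<open>Inl\<close>) or receiving the next argument through a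
  linear map (\<open>Inr\<close>). Freezing slots of a multilinear map leaves a map that is multilinear in the
  remaining arguments; this is how homogeneity in a single coordinate is established.
\<close>

fun fill :: "('v + ('u \<Rightarrow> 'v)) list \<Rightarrow> 'u list \<Rightarrow> 'v list" where
  "fill [] ys = []"
| "fill (Inl v # fs) ys = v # fill fs ys"
| "fill (Inr L # fs) ys = L (hd ys) # fill fs (tl ys)"

lemma length_fill [simp]: "length (fill fs ys) = length fs"
  by (induction fs ys rule: fill.induct) auto

text \<open>
  Each argument enters exactly one slot, so changing it changes one entry of the filled list; hence
  linearity in that slot gives linearity in the argument.
\<close>

lemma fill_update:
  assumes "l < length (filter (Not \<circ> isl) fs)" "length ys = length (filter (Not \<circ> isl) fs)"
  shows "\<exists>p L. p < length fs \<and> Inr L \<in> set fs \<and> (\<forall>y. fill fs (ys[l := y]) = (fill fs ys)[p := L y])"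
  using assms
proof (induction fs ys arbitrary: l rule: fill.induct)
  case (2 v fs ys)
  from "2.IH"[of l] "2.prems" obtain p L where "p < length fs" "Inr L \<in> set fs"
    "\<forall>y. fill fs (ys[l := y]) = (fill fs ys)[p := L y]" by auto
  then show ?case by (intro exI[of _ "Suc p"] exI[of _ L]) auto
next
  case (3 K fs ys)
  then obtain y0 ys' where ys: "ys = y0 # ys'" by (cases ys) auto
  show ?case
  proof (cases l)
    case 0
    then show ?thesis using ys by (intro exI[of _ 0] exI[of _ K]) auto
  next
    case (Suc l')
    with 3 ys obtain p L where "p < length fs" "Inr L \<in> set fs"
      "\<forall>y. fill fs (ys'[l' := y]) = (fill fs ys')[p := L y]" by force
    then show ?thesis using Suc ys by (intro exI[of _ "Suc p"] exI[of _ L]) auto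
  qed
qed auto

lemma set_fill:
  assumes "length ys = length (filter (Not \<circ> isl) fs)" "set ys \<subseteq> U"
    and "\<And>v. Inl v \<in> set fs \<Longrightarrow> v \<in> V" "\<And>L. Inr L \<in> set fs \<Longrightarrow> \<forall>u\<in>U. L u \<in> V"
  shows "set (fill fs ys) \<subseteq> V"
  using assms
proof (induction fs ys rule: fill.induct)
  case (3 K fs ys)
  then obtain y0 ys' where ys: "ys = y0 # ys'" by (cases ys) auto
  then show ?case using 3 by auto
qed auto

lemma fill_replicate:
  "fill fs (replicate (length (filter (Not \<circ> isl) fs)) w) = map (case_sum id (\<lambda>L. L w)) fs"
proof -
  have "fill fs ys = map (case_sum id (\<lambda>L. L w)) fs"
    if "ys = replicate (length (filter (Not \<circ> isl) fs)) w" for ys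
    using that by (induction fs ys rule: fill.induct) auto
  then show ?thesis by blast
qed

lemma homogeneous_map_fill:
  assumes b: "multilinear_map sV sW V (length fs) b"
    and const: "\<And>v. Inl v \<in> set fs \<Longrightarrow> v \<in> V"
    and lin: "\<And>L. Inr L \<in> set fs \<Longrightarrow> linear_into sU sV U V L"
  shows "homogeneous_map sU sW U (length (filter (Not \<circ> isl) fs))
    (\<lambda>w. b (map (case_sum id (\<lambda>L. L w)) fs))"
  unfolding homogeneous_map_def
proof (intro exI conjI ballI)
  show "multilinear_map sU sW U (length (filter (Not \<circ> isl) fs)) (\<lambda>ys. b (fill fs ys))"
    unfolding multilinear_map_def
  proof (intro allI impI)
    fix ys l assume ys: "length ys = length (filter (Not \<circ> isl) fs)" "set ys \<subseteq> U"
      and l: "l < length (filter (Not \<circ> isl) fs)"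
    from fill_update[OF l ys(1)] obtain p L where p: "p < length fs" and "Inr L \<in> set fs"
      and upd: "\<And>y. fill fs (ys[l := y]) = (fill fs ys)[p := L y]" by blast
    with lin have L: "linear_into sU sV U V L" by blast
    have "set (fill fs ys) \<subseteq> V"
      using ys const lin by (intro set_fill) (auto simp: linear_into_def)
    with b p L show "(\<forall>u\<in>U. \<forall>v\<in>U. b (fill fs (ys[l := u + v])) =
        b (fill fs (ys[l := u])) + b (fill fs (ys[l := v]))) \<and>
      (\<forall>c. \<forall>u\<in>U. b (fill fs (ys[l := sU c u])) = sW c (b (fill fs (ys[l := u]))))"
      unfolding upd by (auto simp: multilinear_map_def linear_into_def)
  qed
qed (simp add: fill_replicate)

lemma homogeneous_map_compose_linear:
  assumes "homogeneous_map sV sW V i f" and L: "linear_into sU sV U V L"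
  shows "homogeneous_map sU sW U i (\<lambda>x. f (L x))"
proof -
  from assms obtain b where b: "multilinear_map sV sW V i b" and f: "\<And>x. x \<in> V \<Longrightarrow> f x = b (replicate i x)"
    unfolding homogeneous_map_def by blast
  have "homogeneous_map sU sW U i (\<lambda>w. b (map (case_sum id (\<lambda>L. L w)) (replicate i (Inr L))))"
    using homogeneous_map_fill[of sV sW V "replicate i (Inr L)" b sU U] b L by simp
  then show ?thesis using f L
    by (auto simp: homogeneous_map_def linear_into_def map_replicate_const)
qed

context vector_space_pair
begin

lemma multilinear_map_add:
  assumes "multilinear_map s1 s2 V i b" "length xs + Suc (length ys) = i"
    "set xs \<subseteq> V" "set ys \<subseteq> V" "u \<in> V" "v \<in> V"
  shows "b (xs @ (u + v) # ys) = b (xs @ u # ys) + b (xs @ v # ys)"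
proof -
  let ?zs = "xs @ u # ys"
  have "length ?zs = i" "set ?zs \<subseteq> V" "length xs < i" using assms by auto
  with assms have "b (?zs[length xs := u + v]) = b (?zs[length xs := u]) + b (?zs[length xs := v])"
    unfolding multilinear_map_def by blast
  then show ?thesis by simp
qed

lemma multilinear_map_scale:
  assumes "multilinear_map s1 s2 V i b" "length xs + Suc (length ys) = i"
    "set xs \<subseteq> V" "set ys \<subseteq> V" "u \<in> V"
  shows "b (xs @ s1 c u # ys) = s2 c (b (xs @ u # ys))"
proof -
  let ?zs = "xs @ u # ys"
  have "length ?zs = i" "set ?zs \<subseteq> V" "length xs < i" using assms by auto
  with assms have "b (?zs[length xs := s1 c u]) = s2 c (b (?zs[length xs := u]))"
    unfolding multilinear_map_def by blast
  then show ?thesis by simp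
qed

lemma multilinear_map_sum:
  assumes V: "vs1.subspace V" and b: "multilinear_map s1 s2 V i b" "length xs + Suc (length ys) = i"
    "set xs \<subseteq> V" "set ys \<subseteq> V" and "finite A" and g: "\<And>a. a \<in> A \<Longrightarrow> g a \<in> V"
  shows "b (xs @ (\<Sum>a\<in>A. g a) # ys) = (\<Sum>a\<in>A. b (xs @ g a # ys))"
  using \<open>finite A\<close> g
proof (induction A rule: finite_induct)
  case empty
  have "b (xs @ s1 0 0 # ys) = s2 0 (b (xs @ 0 # ys))"
    using b V by (intro multilinear_map_scale) (auto simp: vs1.subspace_0)
  then show ?case by simp
next
  case (insert a A)
  then have "(\<Sum>a\<in>A. g a) \<in> V" using V by (intro vs1.subspace_sum) auto
  with insert b show ?case by (simp add: multilinear_map_add)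
qed

text \<open>
  The prefix \<open>xs\<close> of arguments that are already expanded is what makes the induction on the number of
  remaining equal arguments go through.
\<close>

lemma multilinear_map_expand:
  assumes V: "vs1.subspace V" and b: "multilinear_map s1 s2 V i b" and A: "finite A"
    and g: "\<And>a. a \<in> A \<Longrightarrow> g a \<in> V" and "length xs + n = i" "set xs \<subseteq> V"
  shows "b (xs @ replicate n (\<Sum>a\<in>A. g a))
    = (\<Sum>\<sigma> | set \<sigma> \<subseteq> A \<and> length \<sigma> = n. b (xs @ map g \<sigma>))"
  using assms(5,6)
proof (induction n arbitrary: xs)
  case 0
  have "{\<sigma>. set \<sigma> \<subseteq> A \<and> length \<sigma> = 0} = {[]}" by auto
  then show ?case by simp
next
  case (Suc n)
  let ?v = "\<Sum>a\<in>A. g a" and ?S = "\<lambda>n. {\<sigma>. set \<sigma> \<subseteq> A \<and> length \<sigma> = n}"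
  have v: "?v \<in> V" using V g by (intro vs1.subspace_sum) auto
  have "b (xs @ replicate (Suc n) ?v) = (\<Sum>a\<in>A. b (xs @ g a # replicate n ?v))"
    using Suc.prems v A g unfolding replicate_Suc
    by (intro multilinear_map_sum[OF V b]) auto
  also have "\<dots> = (\<Sum>a\<in>A. b ((xs @ [g a]) @ replicate n ?v))" by simp
  also have "\<dots> = (\<Sum>a\<in>A. \<Sum>\<sigma>\<in>?S n. b ((xs @ [g a]) @ map g \<sigma>))"
    using Suc g by (intro sum.cong refl Suc.IH) auto
  also have "\<dots> = (\<Sum>\<sigma>\<in>?S n. \<Sum>a\<in>A. b (xs @ map g (a # \<sigma>)))"
    by (subst sum.swap) simp
  also have "\<dots> = (\<Sum>z\<in>?S n \<times> A. b (xs @ map g (snd z # fst z)))"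
    by (simp add: sum.cartesian_product case_prod_beta)
  also have "\<dots> = (\<Sum>\<sigma>\<in>?S (Suc n). b (xs @ map g \<sigma>))"
    unfolding lists_length_Suc_eq
    by (subst sum.reindex) (auto simp: inj_on_def case_prod_beta)
  finally show ?case .
qed

lemma multilinear_map_scale_all:
  assumes b: "multilinear_map s1 s2 V i b" and V: "vs1.subspace V"
    and g: "\<And>a. a \<in> set \<sigma> \<Longrightarrow> g a \<in> V" and "length xs + length \<sigma> = i" "set xs \<subseteq> V"
  shows "b (xs @ map (\<lambda>a. s1 (\<alpha> a) (g a)) \<sigma>)
    = s2 (prod_list (map \<alpha> \<sigma>)) (b (xs @ map g \<sigma>))"
  using assms(3-5)
proof (induction \<sigma> arbitrary: xs)
  case (Cons a \<sigma>)
  have "b (xs @ map (\<lambda>a. s1 (\<alpha> a) (g a)) (a # \<sigma>))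
      = b ((xs @ [s1 (\<alpha> a) (g a)]) @ map (\<lambda>a. s1 (\<alpha> a) (g a)) \<sigma>)" by simp
  also have "\<dots> = s2 (prod_list (map \<alpha> \<sigma>)) (b ((xs @ [s1 (\<alpha> a) (g a)]) @ map g \<sigma>))"
    using Cons.prems V by (intro Cons.IH) (auto intro: vs1.subspace_scale)
  also have "b ((xs @ [s1 (\<alpha> a) (g a)]) @ map g \<sigma>) = s2 (\<alpha> a) (b (xs @ map g (a # \<sigma>)))"
    using Cons.prems multilinear_map_scale[OF b, of xs "map g \<sigma>" "g a" "\<alpha> a"] by auto
  finally show ?case by (simp add: mult.commute)
qed simp

lemma homogeneous_map_scaling:
  assumes "homogeneous_map s1 s2 V i f" "vs1.subspace V" "x \<in> V"
  shows "f (s1 c x) = s2 (c ^ i) (f x)"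
proof -
  from assms obtain b where b: "multilinear_map s1 s2 V i b" and f: "\<And>x. x \<in> V \<Longrightarrow> f x = b (replicate i x)"
    unfolding homogeneous_map_def by blast
  have "b ([] @ map (\<lambda>a. s1 c x) [0..<i]) = s2 (prod_list (map (\<lambda>_. c) [0..<i])) (b ([] @ map (\<lambda>_. x) [0..<i]))"
    by (rule multilinear_map_scale_all[OF b]) (use assms in auto)
  with f assms show ?thesis
    by (simp add: map_replicate_const vs1.subspace_scale prod_list_replicate)
qed

lemma homogeneous_map_zero: "homogeneous_map s1 s2 V i (\<lambda>_. 0)"
  unfolding homogeneous_map_def multilinear_map_def by (intro exI[of _ "\<lambda>_. 0"]) simp

lemma homogeneous_map_add:
  assumes "homogeneous_map s1 s2 V i f" "homogeneous_map s1 s2 V i g"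
  shows "homogeneous_map s1 s2 V i (\<lambda>x. f x + g x)"
proof -
  from assms obtain b b' where b: "multilinear_map s1 s2 V i b" "multilinear_map s1 s2 V i b'"
    and "\<forall>x\<in>V. f x = b (replicate i x)" "\<forall>x\<in>V. g x = b' (replicate i x)"
    unfolding homogeneous_map_def by blast
  moreover from b have "multilinear_map s1 s2 V i (\<lambda>x. b x + b' x)"
    unfolding multilinear_map_def by (simp add: vs2.scale_right_distrib)
  ultimately show ?thesis
    unfolding homogeneous_map_def by (intro exI[of _ "\<lambda>x. b x + b' x"]) simp
qed

lemma homogeneous_map_sum:
  "(\<And>a. a \<in> A \<Longrightarrow> homogeneous_map s1 s2 V i (f a)) \<Longrightarrow> homogeneous_map s1 s2 V i (\<lambda>x. \<Sum>a\<in>A. f a x)"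
  by (induction A rule: infinite_finite_induct) (simp_all add: homogeneous_map_zero homogeneous_map_add)

lemma homogeneous_map_scale:
  assumes "homogeneous_map s1 s2 V i f"
  shows "homogeneous_map s1 s2 V i (\<lambda>x. s2 c (f x))"
proof -
  from assms obtain b where b: "multilinear_map s1 s2 V i b" "\<forall>x\<in>V. f x = b (replicate i x)"
    unfolding homogeneous_map_def by blast
  then have "multilinear_map s1 s2 V i (\<lambda>x. s2 c (b x))"
    unfolding multilinear_map_def by (simp add: vs2.scale_right_distrib mult.commute)
  with b show ?thesis
    unfolding homogeneous_map_def by (intro exI[of _ "\<lambda>x. s2 c (b x)"]) simp
qed

lemma polynomial_map_le_mono:
  assumes "polynomial_map_le s1 s2 V d f" "d \<le> e"
  shows "polynomial_map_le s1 s2 V e f"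
proof -
  from assms(1) obtain q where q: "\<And>i. i \<le> d \<Longrightarrow> homogeneous_map s1 s2 V i (q i)"
    "\<And>x. x \<in> V \<Longrightarrow> f x = (\<Sum>i\<le>d. q i x)"
    unfolding polynomial_map_le_def by blast
  have "(\<Sum>i\<le>d. q i x) = (\<Sum>i\<le>e. (if i \<le> d then q i else (\<lambda>_. 0)) x)" for x
    using \<open>d \<le> e\<close> by (intro sum.mono_neutral_cong_left) auto
  with q show ?thesis unfolding polynomial_map_le_def
    by (intro exI[of _ "\<lambda>i. if i \<le> d then q i else (\<lambda>_. 0)"]) (simp add: homogeneous_map_zero)
qed

lemma polynomial_map_le_homogeneous:
  assumes "homogeneous_map s1 s2 V i f" "i \<le> d"
  shows "polynomial_map_le s1 s2 V d f"
proof -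
  have "f x = (\<Sum>l\<le>d. (if l = i then f else (\<lambda>_. 0)) x)" for x
    using \<open>i \<le> d\<close> by (simp add: if_distrib[of "\<lambda>g. g x"] cong: if_cong)
  with assms show ?thesis unfolding polynomial_map_le_def
    by (intro exI[of _ "\<lambda>l. if l = i then f else (\<lambda>_. 0)"]) (auto simp: homogeneous_map_zero)
qed

lemma polynomial_map_le_add:
  assumes "polynomial_map_le s1 s2 V d f" "polynomial_map_le s1 s2 V d g"
  shows "polynomial_map_le s1 s2 V d (\<lambda>x. f x + g x)"
proof -
  from assms obtain q r where "\<forall>i\<le>d. homogeneous_map s1 s2 V i (q i)" "\<forall>x\<in>V. f x = (\<Sum>i\<le>d. q i x)"
    "\<forall>i\<le>d. homogeneous_map s1 s2 V i (r i)" "\<forall>x\<in>V. g x = (\<Sum>i\<le>d. r i x)"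
    unfolding polynomial_map_le_def by blast
  then show ?thesis unfolding polynomial_map_le_def
    by (intro exI[of _ "\<lambda>i x. q i x + r i x"]) (simp add: homogeneous_map_add sum.distrib)
qed

lemma polynomial_map_le_scale:
  assumes "polynomial_map_le s1 s2 V d f"
  shows "polynomial_map_le s1 s2 V d (\<lambda>x. s2 c (f x))"
proof -
  from assms obtain q where "\<forall>i\<le>d. homogeneous_map s1 s2 V i (q i)" "\<forall>x\<in>V. f x = (\<Sum>i\<le>d. q i x)"
    unfolding polynomial_map_le_def by blast
  then show ?thesis unfolding polynomial_map_le_def
    by (intro exI[of _ "\<lambda>i x. s2 c (q i x)"]) (simp add: homogeneous_map_scale vs2.scale_sum_right)
qed

lemma polynomial_map_le_sum:
  assumes "\<And>a. a \<in> A \<Longrightarrow> polynomial_map_le s1 s2 V d (f a)"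
  shows "polynomial_map_le s1 s2 V d (\<lambda>x. \<Sum>a\<in>A. f a x)"
  using assms
  by (induction A rule: infinite_finite_induct)
    (simp_all add: polynomial_map_le_add polynomial_map_le_homogeneous[OF homogeneous_map_zero[of _ 0]])

lemma polynomial_map_sum:
  assumes "finite A" "\<And>a. a \<in> A \<Longrightarrow> polynomial_map s1 s2 V (f a)"
  shows "polynomial_map s1 s2 V (\<lambda>x. \<Sum>a\<in>A. f a x)"
proof -
  from assms(2) obtain d where d: "\<And>a. a \<in> A \<Longrightarrow> polynomial_map_le s1 s2 V (d a) (f a)"
    unfolding polynomial_map_def by metis
  have "polynomial_map_le s1 s2 V (\<Sum>a\<in>A. d a) (\<lambda>x. \<Sum>a\<in>A. f a x)"
    using assms(1) by (intro polynomial_map_le_sum polynomial_map_le_mono[OF d] member_le_sum) auto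
  then show ?thesis unfolding polynomial_map_def by blast
qed

text \<open>
  Expanding a multilinear map at equal arguments \<open>\<Sum>\<^sub>l t\<^sup>l c\<^sub>l\<close> gives one monomial in \<open>t\<close> for each choice
  of indices, with exponent the sum of the indices.
\<close>

lemma poly_curve_compose_polynomial_map:
  assumes f: "polynomial_map s1 s2 V f" and V: "vs1.subspace V" and \<gamma>: "poly_curve s1 V \<gamma>"
  shows "poly_curve s2 UNIV (\<lambda>t. f (\<gamma> t))"
proof -
  from f obtain d q where q: "\<And>i. i \<le> d \<Longrightarrow> homogeneous_map s1 s2 V i (q i)"
    "\<And>x. x \<in> V \<Longrightarrow> f x = (\<Sum>i\<le>d. q i x)"
    unfolding polynomial_map_def polynomial_map_le_def by blast
  from \<gamma> obtain e c where c: "\<And>i. c i \<in> V" "\<And>t. \<gamma> t = (\<Sum>i\<le>e. s1 (t ^ i) (c i))"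
    unfolding poly_curve_def by blast
  have \<gamma>V: "\<gamma> t \<in> V" for t
    unfolding c(2) using V c(1) by (intro vs1.subspace_sum vs1.subspace_scale) auto
  have "poly_curve s2 UNIV (\<lambda>t. q i (\<gamma> t))" if i: "i \<le> d" for i
  proof -
    from q(1)[OF i] obtain b where b: "multilinear_map s1 s2 V i b" "\<And>x. x \<in> V \<Longrightarrow> q i x = b (replicate i x)"
      unfolding homogeneous_map_def by blast
    have "q i (\<gamma> t) = (\<Sum>\<sigma> | set \<sigma> \<subseteq> {..e} \<and> length \<sigma> = i. s2 (t ^ sum_list \<sigma>) (b (map c \<sigma>)))" for t
    proof -
      have "q i (\<gamma> t) = b ([] @ replicate i (\<Sum>l\<le>e. s1 (t ^ l) (c l)))"
        using b(2)[OF \<gamma>V] by (simp add: c(2))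
      also have "\<dots> = (\<Sum>\<sigma> | set \<sigma> \<subseteq> {..e} \<and> length \<sigma> = i. b ([] @ map (\<lambda>l. s1 (t ^ l) (c l)) \<sigma>))"
        using V c(1) by (intro multilinear_map_expand[OF V b(1)] vs1.subspace_scale) auto
      also have "\<dots> = (\<Sum>\<sigma> | set \<sigma> \<subseteq> {..e} \<and> length \<sigma> = i. s2 (t ^ sum_list \<sigma>) (b (map c \<sigma>)))"
      proof (rule sum.cong[OF refl])
        fix \<sigma> assume "\<sigma> \<in> {\<sigma>. set \<sigma> \<subseteq> {..e} \<and> length \<sigma> = i}"
        moreover have "prod_list (map ((^) t) \<sigma>) = t ^ sum_list \<sigma>"
          by (induction \<sigma>) (simp_all add: power_add)
        ultimately show "b ([] @ map (\<lambda>l. s1 (t ^ l) (c l)) \<sigma>) = s2 (t ^ sum_list \<sigma>) (b (map c \<sigma>))"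
          using multilinear_map_scale_all[OF b(1) V, of \<sigma> c "[]" "(^) t"] c(1) by auto
      qed
      finally show ?thesis .
    qed
    then show ?thesis
      by (simp add: vs2.poly_curve_sum vs2.poly_curve_monom)
  qed
  then have "poly_curve s2 UNIV (\<lambda>t. \<Sum>i\<le>d. q i (\<gamma> t))"
    by (intro vs2.poly_curve_sum) auto
  then show ?thesis using q(2)[OF \<gamma>V] by simp
qed

lemma poly_curve_compose_linear:
  assumes L: "linear_into s1 s2 U V L" and "vs1.subspace U" "poly_curve s1 U \<gamma>"
  shows "poly_curve s2 V (\<lambda>t. L (\<gamma> t))"
proof -
  from assms(3) obtain e c where c: "\<And>i. c i \<in> U" "\<And>t. \<gamma> t = (\<Sum>i\<le>e. s1 (t ^ i) (c i))"
    unfolding poly_curve_def by blast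
  have L0: "L 0 = 0"
  proof -
    have "0 \<in> U" using assms(2) by (rule vs1.subspace_0)
    then have "L (s1 0 0) = s2 0 (L 0)" using L unfolding linear_into_def by blast
    then show ?thesis by simp
  qed
  have "L (\<Sum>i\<in>A. s1 (t ^ i) (c i)) = (\<Sum>i\<in>A. s2 (t ^ i) (L (c i)))" if "finite A" for A t
    using that
  proof (induction A rule: finite_induct)
    case (insert i A)
    have "(\<Sum>i\<in>A. s1 (t ^ i) (c i)) \<in> U" "s1 (t ^ i) (c i) \<in> U"
      using assms(2) c(1) by (auto intro!: vs1.subspace_sum vs1.subspace_scale)
    with insert L c(1) show ?case by (simp add: linear_into_def)
  qed (simp add: L0)
  with c L show ?thesis
    unfolding poly_curve_def by (intro exI[of _ e] exI[of _ "\<lambda>i. L (c i)"]) (simp add: linear_into_def)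
qed

text \<open>
  Along the line \<open>t \<mapsto> t x\<close> the homogeneous components become the coefficients of a polynomial in \<open>t\<close>,
  and an infinite field determines these.
\<close>

lemma homogeneous_component_eqI:
  assumes inf: "infinite (UNIV :: 'a set)"
    and q: "\<And>i. homogeneous_map s1 s2 UNIV i (q i)" and q0: "\<And>i. i > d \<Longrightarrow> q i = (\<lambda>_. 0)"
    and f: "\<And>x. f x = (\<Sum>i\<le>d. q i x)"
  shows "homogeneous_component s1 s2 f = q"
  unfolding homogeneous_component_def
proof (rule the_equality, intro conjI allI)
  show "finite {i. q i \<noteq> (\<lambda>_. 0)}"
    by (rule finite_subset[of _ "{..d}"]) (use q0 in \<open>auto simp: not_less[symmetric]\<close>)
  show "f x = (\<Sum>i | q i \<noteq> (\<lambda>_. 0). q i x)" for x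
    unfolding f by (rule sum.mono_neutral_right) (use q0 in \<open>auto simp: not_less[symmetric]\<close>)
next
  fix r assume "(\<forall>i. homogeneous_map s1 s2 UNIV i (r i)) \<and> finite {i. r i \<noteq> (\<lambda>_. 0)} \<and>
    (\<forall>x. f x = (\<Sum>i | r i \<noteq> (\<lambda>_. 0). r i x))"
  then have r: "\<And>i. homogeneous_map s1 s2 UNIV i (r i)" and fin: "finite {i. r i \<noteq> (\<lambda>_. 0)}"
    and fr: "\<And>x. f x = (\<Sum>i | r i \<noteq> (\<lambda>_. 0). r i x)" by blast+
  show "r = q"
  proof (intro ext)
    fix i x
    define D where "D = Max (insert i (insert d {i. r i \<noteq> (\<lambda>_. 0)}))"
    have D: "i \<le> D" "d \<le> D" "\<And>l. r l \<noteq> (\<lambda>_. 0) \<Longrightarrow> l \<le> D"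
      using fin unfolding D_def by (auto intro!: Max_ge simp del: Max_insert)
    have "(\<Sum>l\<le>D. s2 (t ^ l) (r l x - q l x)) = 0" for t
    proof -
      have "(\<Sum>l\<le>D. r l (s1 t x)) = f (s1 t x)"
        unfolding fr using D(3) by (intro sum.mono_neutral_right) auto
      also have "\<dots> = (\<Sum>l\<le>D. q l (s1 t x))"
        unfolding f using D(2) q0 by (intro sum.mono_neutral_left) (auto simp: not_less[symmetric])
      finally show ?thesis
        using homogeneous_map_scaling[OF r, of x _ t] homogeneous_map_scaling[OF q, of x _ t]
        by (simp add: vs2.scale_right_diff_distrib sum_subtractf)
    qed
    then have "r i x - q i x = 0"
      using vs2.vector_poly_coeffs_zero[OF inf, where d = D and c = "\<lambda>l. r l x - q l x"] D(1) by blast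
    then show "r i x = q i x" by simp
  qed
qed (rule q)

lemma homogeneous_component_of_polynomial_map_le:
  assumes inf: "infinite (UNIV :: 'a set)" and f: "polynomial_map_le s1 s2 UNIV d f"
  shows "homogeneous_map s1 s2 UNIV i (homogeneous_component s1 s2 f i)"
    and "i > d \<Longrightarrow> homogeneous_component s1 s2 f i = (\<lambda>_. 0)"
    and "f x = (\<Sum>i\<le>d. homogeneous_component s1 s2 f i x)"
proof -
  from f obtain r where r: "\<And>i. i \<le> d \<Longrightarrow> homogeneous_map s1 s2 UNIV i (r i)"
    "\<And>x. f x = (\<Sum>i\<le>d. r i x)"
    unfolding polynomial_map_le_def by blast
  define q where "q i = (if i \<le> d then r i else (\<lambda>_. 0))" for i
  have q: "homogeneous_map s1 s2 UNIV i (q i)" "i > d \<Longrightarrow> q i = (\<lambda>_. 0)" "f x = (\<Sum>i\<le>d. q i x)" for i x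
    using r by (auto simp: q_def homogeneous_map_zero)
  have "homogeneous_component s1 s2 f = q"
    by (rule homogeneous_component_eqI[OF inf q])
  with q show "homogeneous_map s1 s2 UNIV i (homogeneous_component s1 s2 f i)"
    "i > d \<Longrightarrow> homogeneous_component s1 s2 f i = (\<lambda>_. 0)"
    "f x = (\<Sum>i\<le>d. homogeneous_component s1 s2 f i x)" by simp_all
qed

end

section \<open>Multihomogeneous decomposition\<close>

text \<open>
  The property by which \<^const>\<open>multihomogeneous_component\<close> selects its family.
\<close>

definition is_multihomogeneous_decomposition ::
  "('k::field \<Rightarrow> 'm::ab_group_add \<Rightarrow> 'm) \<Rightarrow> nat \<Rightarrow> ((nat \<Rightarrow> 'm) \<Rightarrow> 'm) \<Rightarrow>
    (nat list \<Rightarrow> (nat \<Rightarrow> 'm) \<Rightarrow> 'm) \<Rightarrow> bool" where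
  "is_multihomogeneous_decomposition s j f q \<longleftrightarrow>
    (\<forall>p. length p = j \<longrightarrow> multihomogeneous_map s p (q p)) \<and>
    (\<forall>p x. length p \<noteq> j \<or> x \<notin> power_space j \<longrightarrow> q p x = 0) \<and>
    finite {p. q p \<noteq> (\<lambda>_. 0)} \<and>
    (\<forall>x\<in>power_space j. f x = (\<Sum>p | q p \<noteq> (\<lambda>_. 0). q p x))"

context vector_space
begin

lemma vector_space_power_scale: "vector_space (power_scale scale)"
  by unfold_locales (auto simp: power_scale_def fun_eq_iff algebra_simps)

lemma subspace_power_space: "module.subspace (power_scale scale) (power_space j)"
proof -
  interpret pow: vector_space "power_scale scale" by (rule vector_space_power_scale)
  show ?thesis by (auto simp: pow.subspace_def power_space_def power_scale_def)
qed

lemma linear_into_single: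
  "i < j \<Longrightarrow> linear_into scale (power_scale scale) UNIV (power_space j) (\<lambda>y. (\<lambda>_. 0)(i := y))"
  by (auto simp: linear_into_def power_space_def power_scale_def fun_eq_iff)

lemma linear_into_coordinate:
  "i < j \<Longrightarrow> linear_into (power_scale scale) (power_scale scale) (power_space j) (power_space j)
    (\<lambda>x. (\<lambda>_. 0)(i := x i))"
  by (auto simp: linear_into_def power_space_def power_scale_def fun_eq_iff)

lemma power_space_eq_sum: "x \<in> power_space j \<Longrightarrow> x = (\<Sum>l<j. (\<lambda>_. 0)(l := x l))"
proof (rule ext)
  fix i assume "x \<in> power_space j"
  have "(\<Sum>l\<in>A. (\<lambda>_. 0)(l := x l)) i = (\<Sum>l\<in>A. ((\<lambda>_. 0)(l := x l)) i)" if "finite A" for A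
    using that by (induction A rule: finite_induct) auto
  from this[of "{..<j}"] have "(\<Sum>l<j. (\<lambda>_. 0)(l := x l)) i = (\<Sum>l<j. if l = i then x l else 0)"
    by (auto intro!: sum.cong)
  then show "x i = (\<Sum>l<j. (\<lambda>_. 0)(l := x l)) i"
    using \<open>x \<in> power_space j\<close> by (simp add: power_space_def)
qed

text \<open>
  Scaling the coordinates one after the other separates the multidegrees: after \<open>l\<close> steps, the terms
  whose multidegree has a prescribed initial segment of length \<open>l\<close> already sum to zero.
\<close>

lemma multihomogeneous_sum_zero:
  fixes e :: "nat list \<Rightarrow> (nat \<Rightarrow> 'b) \<Rightarrow> 'b"
  assumes inf: "infinite (UNIV :: 'a set)" and "finite P" and len: "\<And>p. p \<in> P \<Longrightarrow> length p = j"
    and scaling: "\<And>p i t x. p \<in> P \<Longrightarrow> i < j \<Longrightarrow> x \<in> power_space j \<Longrightarrow>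
      e p (x(i := scale t (x i))) = scale (t ^ (p ! i)) (e p x)"
    and zero: "\<And>x. x \<in> power_space j \<Longrightarrow> (\<Sum>p\<in>P. e p x) = 0"
    and "p0 \<in> P" "x \<in> power_space j"
  shows "e p0 x = 0"
proof -
  have "\<forall>x\<in>power_space j. (\<Sum>p | p \<in> P \<and> take l p = take l p0. e p x) = 0" if "l \<le> j" for l
    using that
  proof (induction l)
    case 0
    then show ?case using zero by simp
  next
    case (Suc l)
    show ?case
    proof
      fix x :: "nat \<Rightarrow> 'b" assume x: "x \<in> power_space j"
      let ?Q = "{p. p \<in> P \<and> take l p = take l p0}"
      define D where "D = Max ((\<lambda>p. p ! l) ` P)"
      have D: "p ! l \<le> D" if "p \<in> P" for p using that \<open>finite P\<close> by (simp add: D_def)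
      have "(\<Sum>r\<le>D. scale (t ^ r) (\<Sum>p | p \<in> ?Q \<and> p ! l = r. e p x)) = 0" for t
      proof -
        have "(\<Sum>r\<le>D. scale (t ^ r) (\<Sum>p | p \<in> ?Q \<and> p ! l = r. e p x))
            = (\<Sum>r\<le>D. \<Sum>p | p \<in> ?Q \<and> p ! l = r. scale (t ^ (p ! l)) (e p x))"
          by (simp add: scale_sum_right)
        also have "\<dots> = (\<Sum>p\<in>?Q. scale (t ^ (p ! l)) (e p x))"
          using \<open>finite P\<close> D by (intro sum.group) auto
        also have "\<dots> = (\<Sum>p\<in>?Q. e p (x(l := scale t (x l))))"
          using scaling x Suc.prems by (intro sum.cong) auto
        also have "\<dots> = 0"
          using Suc x by (auto simp: power_space_def)
        finally show ?thesis .
      qed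
      from vector_poly_coeffs_zero[OF inf this D[OF \<open>p0 \<in> P\<close>]]
      have "(\<Sum>p | p \<in> ?Q \<and> p ! l = p0 ! l. e p x) = 0" .
      moreover have "{p. p \<in> P \<and> take (Suc l) p = take (Suc l) p0} = {p. p \<in> ?Q \<and> p ! l = p0 ! l}"
        using len Suc.prems \<open>p0 \<in> P\<close> by (auto simp: take_Suc_conv_app_nth)
      ultimately show "(\<Sum>p | p \<in> P \<and> take (Suc l) p = take (Suc l) p0. e p x) = 0" by simp
    qed
  qed
  from this[of j] have "(\<Sum>p | p \<in> P \<and> take j p = take j p0. e p x) = 0" using assms(7) by simp
  moreover have "{p. p \<in> P \<and> take j p = take j p0} = {p0}" using len \<open>p0 \<in> P\<close> by auto
  ultimately show ?thesis by simp
qed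

lemma multihomogeneous_map_scaling:
  assumes "multihomogeneous_map scale p f" "i < length p" "x \<in> power_space (length p)"
  shows "f (x(i := scale t (x i))) = scale (t ^ (p ! i)) (f x)"
proof -
  interpret vector_space_pair scale scale by unfold_locales
  have "homogeneous_map scale scale UNIV (p ! i) (\<lambda>y. f (x(i := y)))"
    using assms by (auto simp: multihomogeneous_map_def)
  from homogeneous_map_scaling[OF this, of "x i" t] show ?thesis by simp
qed

lemma multihomogeneous_decomposition_unique:
  assumes inf: "infinite (UNIV :: 'a set)"
    and q: "is_multihomogeneous_decomposition scale j f q"
    and r: "is_multihomogeneous_decomposition scale j f r"
  shows "q = r"
proof (intro ext)
  fix p0 :: "nat list" and x :: "nat \<Rightarrow> 'b"
  let ?P = "{p. q p \<noteq> (\<lambda>_. 0)} \<union> {p. r p \<noteq> (\<lambda>_. 0)}"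
  have fin: "finite ?P" using q r by (simp add: is_multihomogeneous_decomposition_def)
  have len: "length p = j" if "p \<in> ?P" for p
    using that q r unfolding is_multihomogeneous_decomposition_def by fastforce
  have fq: "f x = (\<Sum>p\<in>?P. q p x)" if "x \<in> power_space j" for x
  proof -
    have "f x = (\<Sum>p | q p \<noteq> (\<lambda>_. 0). q p x)"
      using q that by (simp add: is_multihomogeneous_decomposition_def)
    also have "\<dots> = (\<Sum>p\<in>?P. q p x)" using fin by (intro sum.mono_neutral_left) auto
    finally show ?thesis .
  qed
  have fr: "f x = (\<Sum>p\<in>?P. r p x)" if "x \<in> power_space j" for x
  proof -
    have "f x = (\<Sum>p | r p \<noteq> (\<lambda>_. 0). r p x)"
      using r that by (simp add: is_multihomogeneous_decomposition_def)
    also have "\<dots> = (\<Sum>p\<in>?P. r p x)" using fin by (intro sum.mono_neutral_left) auto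
    finally show ?thesis .
  qed
  show "q p0 x = r p0 x"
  proof (cases "p0 \<in> ?P \<and> x \<in> power_space j")
    case False
    then show ?thesis using q r by (auto simp: is_multihomogeneous_decomposition_def)
  next
    case True
    have "q p0 x - r p0 x = 0"
    proof (rule multihomogeneous_sum_zero[OF inf fin len, where e = "\<lambda>p x. q p x - r p x"])
      fix p i t and x :: "nat \<Rightarrow> 'b" assume p: "p \<in> ?P" "i < j" "x \<in> power_space j"
      with len have "multihomogeneous_map scale p (q p)" "multihomogeneous_map scale p (r p)"
        "length p = j"
        using q r by (auto simp: is_multihomogeneous_decomposition_def)
      with p show "q p (x(i := scale t (x i))) - r p (x(i := scale t (x i)))
          = scale (t ^ (p ! i)) (q p x - r p x)"
        using multihomogeneous_map_scaling[of p "q p" i x t] multihomogeneous_map_scaling[of p "r p" i x t]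
        by (simp add: scale_right_diff_distrib)
    next
      show "(\<Sum>p\<in>?P. q p x - r p x) = 0" if "x \<in> power_space j" for x
        using fq[OF that] fr[OF that] by (simp add: sum_subtractf)
    qed (use True in auto)
    then show ?thesis by simp
  qed
qed

text \<open>
  Decompose each argument of the multilinear map into its \<open>j\<close> coordinates and expand. A term is indexed
  by the list of coordinates used in the successive slots; its degree in a coordinate is the number
  of occurrences of that coordinate in the list.
\<close>

lemma multihomogeneous_decomposition_exists:
  assumes f: "polynomial_map (power_scale scale) scale (power_space j) f"
  shows "\<exists>q. is_multihomogeneous_decomposition scale j f q"
proof -
  interpret pow: vector_space "power_scale scale" by (rule vector_space_power_scale)
  interpret pow: vector_space_pair "power_scale scale" scale by unfold_locales
  interpret id: vector_space_pair scale scale by unfold_locales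
  let ?V = "power_space j :: (nat \<Rightarrow> 'b) set"
  from f obtain d g where g: "\<And>i. i \<le> d \<Longrightarrow> homogeneous_map (power_scale scale) scale ?V i (g i)"
    and fg: "\<And>x. x \<in> ?V \<Longrightarrow> f x = (\<Sum>i\<le>d. g i x)"
    unfolding polynomial_map_def polynomial_map_le_def by blast
  from g obtain b where b: "\<And>i. i \<le> d \<Longrightarrow> multilinear_map (power_scale scale) scale ?V i (b i)"
    and gb: "\<And>i x. i \<le> d \<Longrightarrow> x \<in> ?V \<Longrightarrow> g i x = b i (replicate i x)"
    unfolding homogeneous_map_def by metis
  define S where "S i = {\<sigma>. set \<sigma> \<subseteq> {..<j} \<and> length \<sigma> = i}" for i
  define I where "I = Sigma {..d} S"
  define cnt where "cnt z = map (count_list (snd z)) [0..<j]" for z :: "nat \<times> nat list"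
  define trm where "trm z x = b (fst z) (map (\<lambda>l. (\<lambda>_. 0)(l := x l)) (snd z))" for z x
  define q where "q p x = (if x \<in> ?V then (\<Sum>z | z \<in> I \<and> cnt z = p. trm z x) else 0)" for p x
  have [simp]: "finite (S i)" for i unfolding S_def by (rule finite_lists_length_eq) simp
  have finI: "finite I" by (simp add: I_def)
  have expand: "f x = (\<Sum>z\<in>I. trm z x)" if x: "x \<in> ?V" for x
  proof -
    have "g i x = (\<Sum>\<sigma>\<in>S i. trm (i, \<sigma>) x)" if i: "i \<le> d" for i
    proof -
      have "g i x = b i ([] @ replicate i (\<Sum>l<j. (\<lambda>_. 0)(l := x l)))"
        using gb[OF i x] power_space_eq_sum[OF x] by simp
      also have "\<dots> = (\<Sum>\<sigma> | set \<sigma> \<subseteq> {..<j} \<and> length \<sigma> = i. b i ([] @ map (\<lambda>l. (\<lambda>_. 0)(l := x l)) \<sigma>))"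
        by (intro pow.multilinear_map_expand[OF subspace_power_space b[OF i]])
          (auto simp: power_space_def)
      finally show ?thesis by (simp add: S_def trm_def)
    qed
    then have "f x = (\<Sum>i\<le>d. \<Sum>\<sigma>\<in>S i. trm (i, \<sigma>) x)" using fg[OF x] by simp
    also have "\<dots> = (\<Sum>z\<in>I. trm z x)" by (simp add: I_def sum.Sigma)
    finally show ?thesis .
  qed
  have hom: "homogeneous_map (power_scale scale) scale ?V (fst z) (trm z)" if "z \<in> I" for z
  proof -
    from that have z: "fst z \<le> d" "length (snd z) = fst z" "set (snd z) \<subseteq> {..<j}"
      by (auto simp: I_def S_def)
    let ?fs = "map (\<lambda>l. Inr (\<lambda>x. (\<lambda>_. 0)(l := x l))) (snd z)
      :: ((nat \<Rightarrow> 'b) + ((nat \<Rightarrow> 'b) \<Rightarrow> (nat \<Rightarrow> 'b))) list"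
    have "homogeneous_map (power_scale scale) scale ?V (length (filter (Not \<circ> isl) ?fs))
        (\<lambda>w. b (fst z) (map (case_sum id (\<lambda>L. L w)) ?fs))"
    proof (rule homogeneous_map_fill[where b = "b (fst z)" and fs = ?fs and V = ?V])
      show "multilinear_map (power_scale scale) scale ?V (length ?fs) (b (fst z))"
        using b z by simp
      show "linear_into (power_scale scale) (power_scale scale) ?V ?V L" if "Inr L \<in> set ?fs" for L
        using that z linear_into_coordinate by auto
    qed auto
    moreover have "length (filter (Not \<circ> isl) ?fs) = fst z" using z by (simp add: comp_def)
    ultimately show ?thesis by (simp add: trm_def[abs_def] comp_def)
  qed
  have hom1: "homogeneous_map scale scale UNIV (count_list (snd z) i) (\<lambda>y. trm z (x(i := y)))"
    if "z \<in> I" "i < j" and x: "x \<in> ?V" for z i x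
  proof -
    from that have z: "fst z \<le> d" "length (snd z) = fst z" "set (snd z) \<subseteq> {..<j}"
      by (auto simp: I_def S_def)
    define F :: "nat \<Rightarrow> (nat \<Rightarrow> 'b) + ('b \<Rightarrow> (nat \<Rightarrow> 'b))"
      where "F l = (if l = i then Inr (\<lambda>y. (\<lambda>_. 0)(i := y)) else Inl ((\<lambda>_. 0)(l := x l)))" for l
    have "homogeneous_map scale scale UNIV (length (filter (Not \<circ> isl) (map F (snd z))))
        (\<lambda>w. b (fst z) (map (case_sum id (\<lambda>L. L w)) (map F (snd z))))"
    proof (rule homogeneous_map_fill[where V = ?V])
      show "multilinear_map (power_scale scale) scale ?V (length (map F (snd z))) (b (fst z))"
        using b z by simp
      show "v \<in> ?V" if "Inl v \<in> set (map F (snd z))" for v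
        using that z by (auto simp: F_def power_space_def split: if_splits)
      show "linear_into scale (power_scale scale) UNIV ?V L" if "Inr L \<in> set (map F (snd z))" for L
        using that z linear_into_single[OF \<open>i < j\<close>] by (auto simp: F_def split: if_splits)
    qed
    moreover have "length (filter (Not \<circ> isl) (map F \<sigma>)) = count_list \<sigma> i" for \<sigma>
      by (induction \<sigma>) (auto simp: F_def)
    moreover have "map (case_sum id (\<lambda>L. L w)) (map F \<sigma>) = map (\<lambda>l. (\<lambda>_. 0)(l := (x(i := w)) l)) \<sigma>"
      for w \<sigma> by (simp add: F_def)
    ultimately show ?thesis unfolding trm_def by (simp only:)
  qed
  have q0: "q p = (\<lambda>_. 0)" if "p \<notin> cnt ` I" for p
  proof -
    from that have "{z. z \<in> I \<and> cnt z = p} = {}" by auto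
    then show ?thesis by (simp only: q_def fun_eq_iff) simp
  qed
  have "is_multihomogeneous_decomposition scale j f q"
    unfolding is_multihomogeneous_decomposition_def multihomogeneous_map_def
  proof (intro conjI allI impI ballI)
    fix p :: "nat list" assume p: "length p = j"
    have "polynomial_map (power_scale scale) scale ?V (\<lambda>x. \<Sum>z | z \<in> I \<and> cnt z = p. trm z x)"
    proof (rule pow.polynomial_map_sum)
      show "polynomial_map (power_scale scale) scale ?V (trm z)" if "z \<in> {z. z \<in> I \<and> cnt z = p}" for z
        using pow.polynomial_map_le_homogeneous[OF hom order_refl] that
        unfolding polynomial_map_def by blast
    qed (use finI in auto)
    then show "polynomial_map (power_scale scale) scale (power_space (length p)) (q p)"
      using p by (simp add: q_def polynomial_map_def polynomial_map_le_def)
    fix i and x :: "nat \<Rightarrow> 'b" assume i: "i < length p" and x: "x \<in> power_space (length p)"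
    have "homogeneous_map scale scale UNIV (p ! i) (\<lambda>y. trm z (x(i := y)))"
      if "z \<in> I" "cnt z = p" for z
    proof -
      have "p ! i = cnt z ! i" using that(2) by simp
      also have "\<dots> = count_list (snd z) i" using i p by (simp add: cnt_def)
      finally have "p ! i = count_list (snd z) i" .
      then show ?thesis using hom1[OF that(1), of i x] i x p by simp
    qed
    then have "homogeneous_map scale scale UNIV (p ! i)
        (\<lambda>y. \<Sum>z | z \<in> I \<and> cnt z = p. trm z (x(i := y)))"
      by (intro id.homogeneous_map_sum) auto
    moreover have "x(i := y) \<in> ?V" for y using i x p by (auto simp: power_space_def)
    ultimately show "homogeneous_map scale scale UNIV (p ! i) (\<lambda>y. q p (x(i := y)))"
      by (simp add: q_def)
  next
    fix p :: "nat list" and x :: "nat \<Rightarrow> 'b" assume "length p \<noteq> j \<or> x \<notin> ?V"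
    moreover have "q p x = 0" if "x \<notin> ?V" using that by (simp add: q_def)
    moreover have "q p = (\<lambda>_. 0)" if "length p \<noteq> j"
    proof (rule q0)
      have "length (cnt z) = j" for z by (simp add: cnt_def)
      with that show "p \<notin> cnt ` I" by blast
    qed
    ultimately show "q p x = 0" by auto
  next
    show "finite {p. q p \<noteq> (\<lambda>_. 0)}"
      by (rule finite_subset[of _ "cnt ` I"]) (use q0 finI in auto)
    fix x :: "nat \<Rightarrow> 'b" assume x: "x \<in> ?V"
    have "f x = (\<Sum>p\<in>cnt ` I. \<Sum>z | z \<in> I \<and> cnt z = p. trm z x)"
      using sum.image_gen[OF finI, of "\<lambda>z. trm z x" cnt] expand[OF x] by simp
    also have "\<dots> = (\<Sum>p\<in>cnt ` I. q p x)" using x by (simp add: q_def)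
    also have "\<dots> = (\<Sum>p | q p \<noteq> (\<lambda>_. 0). q p x)"
      using finI q0 by (intro sum.mono_neutral_right) auto
    finally show "f x = (\<Sum>p | q p \<noteq> (\<lambda>_. 0). q p x)" .
  qed
  then show ?thesis by blast
qed

lemma multihomogeneous_component_decomposition:
  assumes "infinite (UNIV :: 'a set)" "polynomial_map (power_scale scale) scale (power_space j) f"
  shows "is_multihomogeneous_decomposition scale j f (multihomogeneous_component scale j f)"
proof -
  from multihomogeneous_decomposition_exists[OF assms(2)] obtain q
    where q: "is_multihomogeneous_decomposition scale j f q" ..
  have "multihomogeneous_component scale j f = (THE q. is_multihomogeneous_decomposition scale j f q)"
    unfolding multihomogeneous_component_def is_multihomogeneous_decomposition_def ..
  also have "\<dots> = q"
    using q multihomogeneous_decomposition_unique[OF assms(1) _ q] by (rule the_equality)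
  finally show ?thesis using q by simp
qed

end

section \<open>The maps \<open>\<psi>\<^sub>j\<close> as finite differences of the power map\<close>

fun difference :: "nat \<Rightarrow> (nat \<Rightarrow> 'm::ab_group_add) \<Rightarrow> nat \<Rightarrow> 'm" where
  "difference 0 u n = u n"
| "difference (Suc m) u n = difference m u (Suc n) - difference m u n"

text \<open>
  Newton's interpolation formula; the induction step is Pascal's rule.
\<close>

lemma (in vector_space) newton_forward_difference:
  "difference m u n = (\<Sum>p\<le>n. scale (of_nat (n choose p)) (difference (m + p) u 0))"
proof (induction n arbitrary: m)
  case (Suc n)
  let ?d = "\<lambda>p. difference (m + p) u 0"
  have "(\<Sum>p\<le>Suc n. scale (of_nat (Suc n choose p)) (?d p))
      = ?d 0 + (\<Sum>p\<le>n. scale (of_nat (Suc n choose Suc p)) (?d (Suc p)))"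
    by (simp add: sum.atMost_Suc_shift del: binomial_Suc_Suc sum.atMost_Suc)
  also have "\<dots> = (\<Sum>p\<le>n. scale (of_nat (n choose p)) (?d (Suc p)))
      + (?d 0 + (\<Sum>p\<le>n. scale (of_nat (n choose Suc p)) (?d (Suc p))))"
    by (simp add: scale_left_distrib sum.distrib add_ac del: difference.simps)
  also have "?d 0 + (\<Sum>p\<le>n. scale (of_nat (n choose Suc p)) (?d (Suc p)))
      = (\<Sum>p\<le>Suc n. scale (of_nat (n choose p)) (?d p))"
    by (simp add: sum.atMost_Suc_shift del: sum.atMost_Suc)
  also have "\<dots> = (\<Sum>p\<le>n. scale (of_nat (n choose p)) (?d p))"
    by (simp add: binomial_eq_0)
  also have "\<dots> = difference m u n" using Suc.IH[of m] by simp
  also have "(\<Sum>p\<le>n. scale (of_nat (n choose p)) (?d (Suc p))) = difference (Suc m) u n"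
    using Suc.IH[of "Suc m"] by simp
  finally show ?case by simp
qed simp

locale polynomial_group_char_0 = polynomial_group scale G k
  for scale :: "'k::field_char_0 \<Rightarrow> 'm::ab_group_add \<Rightarrow> 'm" and G :: "'m monoid" (structure) and k
begin

sublocale endo: vector_space_pair scale scale by unfold_locales

sublocale pow: vector_space_pair "power_scale scale" scale
  by (intro vector_space_pair.intro vector_space_power_scale) unfold_locales

lemma in_carrier [simp]: "x \<in> carrier G" by (simp add: carrier_eq)

lemma infinite_field: "infinite (UNIV :: 'k set)" by (rule infinite_UNIV_char_0)

lemma iterated_product_Suc: "iterated_product G (Suc j) x = iterated_product G j x \<otimes> x j"
proof -
  have "foldr (\<otimes>) xs a = foldr (\<otimes>) xs \<one> \<otimes> a" for xs a
    by (induction xs) (simp_all add: m_assoc)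
  from this[of "map x [0..<j]" "x j"] show ?thesis by (simp add: iterated_product_def)
qed

lemma iterated_product_indicator:
  "iterated_product G j (\<lambda>i. if i \<in> S then x else 0) = x [^] card (S \<inter> {..<j})"
proof (induction j)
  case 0
  then show ?case by (simp add: iterated_product_def)
next
  case (Suc j)
  show ?case
  proof (cases "j \<in> S")
    case True
    then have "S \<inter> {..<Suc j} = insert j (S \<inter> {..<j})" by auto
    then show ?thesis using True Suc by (simp add: iterated_product_Suc)
  next
    case False
    then have "S \<inter> {..<Suc j} = S \<inter> {..<j}" by (auto simp: less_Suc_eq)
    then show ?thesis using False Suc one_eq by (simp add: iterated_product_Suc flip: one_eq)
  qed
qed

lemma power_eq_iterated_product: "x [^] j = iterated_product G j (diagonal j x)"
  using iterated_product_indicator[of j "{..<j}" x] by (simp add: diagonal_def)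

lemma poly_curve_mult:
  assumes "poly_curve scale UNIV \<gamma>" "poly_curve scale UNIV \<delta>"
  shows "poly_curve scale UNIV (\<lambda>t. \<gamma> t \<otimes> \<delta> t)"
proof -
  interpret single: vector_space_pair scale "power_scale scale"
    by (intro vector_space_pair.intro vector_space_power_scale) unfold_locales
  let ?c = "\<lambda>t. (\<lambda>_. 0)(0 := \<gamma> t) + (\<lambda>_. 0)(1 := \<delta> t) :: nat \<Rightarrow> 'm"
  have "poly_curve (power_scale scale) (power_space 2) ?c"
    using assms by (intro pow.vs1.poly_curve_add subspace_power_space
      single.poly_curve_compose_linear[OF linear_into_single]) auto
  moreover have "polynomial_map (power_scale scale) scale (power_space 2) (iterated_product G 2)"
    using iterated_product_polynomial unfolding polynomial_map_def by blast
  ultimately have "poly_curve scale UNIV (\<lambda>t. iterated_product G 2 (?c t))"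
    using pow.poly_curve_compose_polynomial_map subspace_power_space by blast
  moreover have "iterated_product G 2 (?c t) = \<gamma> t \<otimes> \<delta> t" for t
    by (simp add: numeral_2_eq_2 iterated_product_Suc) (simp add: iterated_product_def)
  ultimately show ?thesis by simp
qed

lemma multihomogeneous_decomposition_iterated_product:
  "is_multihomogeneous_decomposition scale j (iterated_product G j)
    (multihomogeneous_component scale j (iterated_product G j))"
  using iterated_product_polynomial unfolding polynomial_map_def
  by (intro multihomogeneous_component_decomposition infinite_field) (auto simp: polynomial_map_def)

text \<open>
  Replacing the \<open>l\<close>-th argument by \<open>0\<close> fixes the components of degree \<open>0\<close> in that argument and kills all
  others. Hence requiring positive degree in one further argument amounts to subtracting the value
  with that argument deleted. On arguments in \<open>{0, x}\<close> the iterated product is a power of \<open>x\<close>, the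
  exponent being the number of arguments equal to \<open>x\<close>, so each such step is a finite difference.
\<close>

lemma psi_eq_difference: "psi scale G j x = difference j (\<lambda>n. x [^] n) 0"
proof -
  define q where "q = multihomogeneous_component scale j (iterated_product G j)"
  have q: "is_multihomogeneous_decomposition scale j (iterated_product G j) q"
    unfolding q_def by (rule multihomogeneous_decomposition_iterated_product)
  define P where "P = {p. q p \<noteq> (\<lambda>_. 0)}"
  have P: "finite P" "\<And>p. p \<in> P \<Longrightarrow> length p = j \<and> multihomogeneous_map scale p (q p)"
    using q by (auto simp: P_def is_multihomogeneous_decomposition_def)
  define y where "y S = (\<lambda>i. if i \<in> S then x else 0)" for S :: "nat set"
  have "(\<Sum>p | p \<in> P \<and> (\<forall>i<l. p ! i > 0). q p (y S)) = difference l (\<lambda>n. x [^] n) (card S - l)"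
    if "l \<le> j" "{..<l} \<subseteq> S" "S \<subseteq> {..<j}" for l S
    using that
  proof (induction l arbitrary: S)
    case 0
    then have "S \<inter> {..<j} = S" by auto
    moreover have "y S \<in> power_space j" using 0 by (auto simp: y_def power_space_def)
    ultimately show ?case
      using q iterated_product_indicator[of j S x]
      by (simp add: is_multihomogeneous_decomposition_def P_def y_def)
  next
    case (Suc l)
    have "finite S" using Suc.prems finite_subset by blast
    have "l \<in> S" using Suc.prems by auto
    have "card {..<Suc l} \<le> card S" using Suc.prems \<open>finite S\<close> by (intro card_mono) auto
    then have card: "card S - l = Suc (card S - Suc l)" "card (S - {l}) - l = card S - Suc l"
      using \<open>l \<in> S\<close> \<open>finite S\<close> by auto
    have drop: "q p (y S) - q p (y (S - {l})) = (if p ! l > 0 then q p (y S) else 0)" if "p \<in> P" for p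
    proof -
      \<comment> \<open>Scaling the coordinate \<open>l\<close> by 0 uses \<open>0 ^ 0 = 1\<close> to keep the components of degree 0 in it.\<close>
      have "y S \<in> power_space (length p)" "l < length p"
        using Suc.prems P(2)[OF that] by (auto simp: y_def power_space_def)
      from multihomogeneous_map_scaling[OF _ this(2,1), of "q p" 0] P(2)[OF that]
      have "q p ((y S)(l := 0)) = scale (0 ^ (p ! l)) (q p (y S))" by simp
      moreover have "(y S)(l := 0) = y (S - {l})" by (auto simp: y_def)
      ultimately show ?thesis by simp
    qed
    have "(\<Sum>p | p \<in> P \<and> (\<forall>i<Suc l. p ! i > 0). q p (y S))
        = (\<Sum>p | p \<in> P \<and> (\<forall>i<l. p ! i > 0). if p ! l > 0 then q p (y S) else 0)"
      using P(1) by (intro sum.mono_neutral_cong_left) (auto simp: less_Suc_eq)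
    also have "\<dots> = (\<Sum>p | p \<in> P \<and> (\<forall>i<l. p ! i > 0). q p (y S) - q p (y (S - {l})))"
      using drop by (intro sum.cong) auto
    also have "\<dots> = difference l (\<lambda>n. x [^] n) (card S - l)
        - difference l (\<lambda>n. x [^] n) (card (S - {l}) - l)"
      unfolding sum_subtractf using Suc.prems by (intro arg_cong2[of _ _ _ _ "(-)"] Suc.IH) auto
    finally show ?case using card by simp
  qed
  from this[of j "{..<j}"]
  have "(\<Sum>p | p \<in> P \<and> (\<forall>i<j. p ! i > 0). q p (diagonal j x)) = difference j (\<lambda>n. x [^] n) 0"
    by (simp add: y_def diagonal_def)
  moreover have "{p. length p = j \<and> (\<forall>i<j. p ! i > 0) \<and> q p \<noteq> (\<lambda>_. 0)}
      = {p. p \<in> P \<and> (\<forall>i<j. p ! i > 0)}"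
    using P(2) by (auto simp: P_def)
  ultimately show ?thesis by (simp add: psi_def q_def[symmetric])
qed

lemma psi_0: "psi scale G 0 x = 0"
  by (simp add: psi_eq_difference one_eq)

lemma psi_1: "psi scale G 1 x = x"
  by (simp add: psi_eq_difference one_eq)

lemma psi_polynomial_map_le: "polynomial_map_le scale scale UNIV k (psi scale G j)"
proof -
  have pow: "polynomial_map_le scale scale UNIV k (\<lambda>x. x [^] n)" for n :: nat
  proof -
    have diag: "linear_into scale (power_scale scale) UNIV (power_space n) (diagonal n)"
      by (auto simp: linear_into_def power_space_def power_scale_def diagonal_def fun_eq_iff)
    from iterated_product_polynomial[of n] obtain q
      where q: "\<And>i. i \<le> k \<Longrightarrow> homogeneous_map (power_scale scale) scale (power_space n) i (q i)"
      "\<And>x. x \<in> power_space n \<Longrightarrow> iterated_product G n x = (\<Sum>i\<le>k. q i x)"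
      unfolding polynomial_map_le_def by blast
    have "x [^] n = (\<Sum>i\<le>k. q i (diagonal n x))" for x
      using q(2)[of "diagonal n x"] diag by (simp add: power_eq_iterated_product linear_into_def)
    with homogeneous_map_compose_linear[OF q(1) diag] show ?thesis
      unfolding polynomial_map_le_def by (intro exI[of _ "\<lambda>i x. q i (diagonal n x)"]) simp
  qed
  have "polynomial_map_le scale scale UNIV k (\<lambda>x. difference m (\<lambda>n. x [^] n) n)" for m n
  proof (induction m arbitrary: n)
    case (Suc m)
    have "polynomial_map_le scale scale UNIV k
      (\<lambda>x. difference m (\<lambda>n. x [^] n) (Suc n) + scale (-1) (difference m (\<lambda>n. x [^] n) n))"
      by (intro endo.polynomial_map_le_add endo.polynomial_map_le_scale Suc)
    then show ?case by simp
  qed (simp add: pow)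
  from this[of j 0] show ?thesis by (simp add: psi_eq_difference[abs_def])
qed

lemma psi_component_homogeneous: "homogeneous_map scale scale UNIV m (psi_component scale G j m)"
  and psi_component_above: "m > k \<Longrightarrow> psi_component scale G j m = (\<lambda>_. 0)"
  and psi_eq_sum_components: "psi scale G j x = (\<Sum>m\<le>k. psi_component scale G j m x)"
  unfolding psi_component_def
  by (rule endo.homogeneous_component_of_polynomial_map_le[OF infinite_field psi_polynomial_map_le];
      assumption?)+

text \<open>
  A component of multidegree \<open>(p\<^sub>1, \<dots>, p\<^sub>j)\<close> with all \<open>p\<^sub>i > 0\<close> has degree \<open>\<Sum>\<^sub>i p\<^sub>i \<ge> j\<close> on the diagonal.
\<close>

lemma psi_component_below:
  assumes "m < j"
  shows "psi_component scale G j m x = 0"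
proof (cases "m \<le> k")
  case False
  then show ?thesis by (simp add: psi_component_above)
next
  case True
  define q where "q = multihomogeneous_component scale j (iterated_product G j)"
  have q: "is_multihomogeneous_decomposition scale j (iterated_product G j) q"
    unfolding q_def by (rule multihomogeneous_decomposition_iterated_product)
  define P where "P = {p. length p = j \<and> (\<forall>i<j. p ! i > 0) \<and> q p \<noteq> (\<lambda>_. 0)}"
  have finP: "finite P"
    by (rule finite_subset[of _ "{p. q p \<noteq> (\<lambda>_. 0)}"])
      (use q in \<open>auto simp: P_def is_multihomogeneous_decomposition_def\<close>)
  define e where "e p = (\<Sum>i<j. p ! i)" for p :: "nat list"
  have scaling: "q p (diagonal j (scale t x)) = scale (t ^ e p) (q p (diagonal j x))" if "p \<in> P" for p t
  proof -
    define y where "y l = (\<lambda>i. if i < l then scale t x else if i < j then x else 0)" for l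
    have "q p (y l) = scale (t ^ (\<Sum>i<l. p ! i)) (q p (diagonal j x))" if "l \<le> j" for l
      using that
    proof (induction l)
      case 0
      then show ?case by (simp add: y_def diagonal_def)
    next
      case (Suc l)
      have "y l \<in> power_space (length p)" "l < length p" "multihomogeneous_map scale p (q p)"
        using Suc.prems \<open>p \<in> P\<close> q by (auto simp: y_def power_space_def P_def is_multihomogeneous_decomposition_def)
      from multihomogeneous_map_scaling[OF this(3,2,1), of t]
      have "q p ((y l)(l := scale t (y l l))) = scale (t ^ (p ! l)) (q p (y l))" .
      moreover have "(y l)(l := scale t (y l l)) = y (Suc l)"
        using Suc.prems by (auto simp: y_def)
      ultimately show ?case using Suc by (simp add: power_add mult.commute)
    qed
    from this[of j] show ?thesis by (simp add: y_def diagonal_def[abs_def] e_def cong: if_cong)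
  qed
  have e_ge: "e p \<ge> j" if "p \<in> P" for p
  proof -
    have "(\<Sum>i<j. 1) \<le> e p"
      unfolding e_def using that by (intro sum_mono) (auto simp: P_def Suc_le_eq)
    then show ?thesis by simp
  qed
  define D where "D = Max (insert k (e ` P))"
  have D: "k \<le> D" "\<And>p. p \<in> P \<Longrightarrow> e p \<le> D"
    using finP unfolding D_def by (auto intro!: Max_ge simp del: Max_insert)
  define w where "w i = (\<Sum>p | p \<in> P \<and> e p = i. q p (diagonal j x))" for i
  have "(\<Sum>i\<le>D. scale (t ^ i) (psi_component scale G j i x - w i)) = 0" for t
  proof -
    have "(\<Sum>i\<le>D. scale (t ^ i) (w i)) = (\<Sum>i\<le>D. \<Sum>p | p \<in> P \<and> e p = i. scale (t ^ e p) (q p (diagonal j x)))"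
      by (simp add: w_def scale_sum_right)
    also have "\<dots> = (\<Sum>p\<in>P. scale (t ^ e p) (q p (diagonal j x)))"
      using finP D by (intro sum.group) auto
    also have "\<dots> = psi scale G j (scale t x)"
      using scaling by (simp add: psi_def q_def[symmetric] P_def[symmetric])
    also have "\<dots> = (\<Sum>i\<le>D. psi_component scale G j i (scale t x))"
      unfolding psi_eq_sum_components using D(1)
      by (intro sum.mono_neutral_left) (auto simp: psi_component_above)
    also have "\<dots> = (\<Sum>i\<le>D. scale (t ^ i) (psi_component scale G j i x))"
      using endo.homogeneous_map_scaling[OF psi_component_homogeneous] by simp
    finally show ?thesis by (simp add: scale_right_diff_distrib sum_subtractf)
  qed
  from vector_poly_coeffs_zero[OF infinite_field this, of m]
  have "psi_component scale G j m x = w m" using True D(1) by simp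
  also have "{p. p \<in> P \<and> e p = m} = {}" using e_ge \<open>m < j\<close> by force
  then have "w m = 0" by (simp only: w_def) simp
  finally show ?thesis .
qed

text \<open>
  The bound \<open>k\<close> on the degree from above and the bound \<open>j\<close> from below leave no room.
\<close>

lemma psi_above: "j > k \<Longrightarrow> psi scale G j x = 0"
  by (simp add: psi_eq_sum_components psi_component_below)

lemma power_eq_sum_psi: "x [^] n = (\<Sum>p\<le>k. scale (of_nat (n choose p)) (psi scale G p x))"
proof -
  let ?f = "\<lambda>p. scale (of_nat (n choose p)) (psi scale G p x)"
  have "x [^] n = (\<Sum>p\<le>n. ?f p)"
    using newton_forward_difference[of 0 "\<lambda>n. x [^] n" n] by (simp add: psi_eq_difference)
  also have "\<dots> = (\<Sum>p\<le>max n k. ?f p)"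
    by (intro sum.mono_neutral_left) (auto simp: binomial_eq_0)
  also have "\<dots> = (\<Sum>p\<le>k. ?f p)"
    by (intro sum.mono_neutral_right) (auto simp: psi_above)
  finally show ?thesis .
qed

end

section \<open>Powers with exponents in the field\<close>

context polynomial_group_char_0
begin

text \<open>
  The power \<open>x\<^sup>t\<close>, by Newton's formula for \<open>x\<^sup>n\<close> with \<open>n\<close> replaced by a scalar \<open>t\<close>.
\<close>

definition scalar_power :: "'m \<Rightarrow> 'k \<Rightarrow> 'm" where
  "scalar_power x t = (\<Sum>p\<le>k. scale (t gchoose p) (psi scale G p x))"

lemma scalar_power_of_nat: "scalar_power x (of_nat n) = x [^] n"
  by (simp add: scalar_power_def power_eq_sum_psi binomial_gbinomial)

lemma poly_curve_scalar_power: "poly_curve scale UNIV (scalar_power x)"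
proof -
  have "poly_curve scale UNIV (\<lambda>t. scale (t gchoose p) (psi scale G p x))" for p
    by (rule poly_curve_scale[where P = "smult (1 / fact p) (\<Prod>i=0..<p. [:- of_nat i, 1:])"])
      (simp_all add: poly_curve_const gbinomial_prod_rev poly_prod)
  then show ?thesis unfolding scalar_power_def[abs_def] by (intro poly_curve_sum) auto
qed

lemma psi_polynomial_map: "polynomial_map scale scale UNIV (psi scale G j)"
  using psi_polynomial_map_le unfolding polynomial_map_def by blast

lemma poly_curve_scalar_power_base:
  assumes "poly_curve scale UNIV \<gamma>"
  shows "poly_curve scale UNIV (\<lambda>t. scalar_power (\<gamma> t) s)"
proof -
  have "poly_curve scale UNIV (\<lambda>t. scale (s gchoose p) (psi scale G p (\<gamma> t)))" for p
    by (intro poly_curve_scale[where P = "[:s gchoose p:]"]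
        endo.poly_curve_compose_polynomial_map[OF psi_polynomial_map] assms) auto
  then show ?thesis unfolding scalar_power_def by (intro poly_curve_sum) auto
qed

text \<open>
  Both sides are polynomial in \<open>s\<close> for fixed \<open>t\<close> and in \<open>t\<close> for fixed \<open>s\<close>, so that the law may be extended
  from natural numbers in one variable at a time. The same holds for the next law.
\<close>

lemma scalar_power_add: "scalar_power x (s + t) = scalar_power x s \<otimes> scalar_power x t"
proof -
  have nat: "scalar_power x (s + of_nat n) = scalar_power x s \<otimes> scalar_power x (of_nat n)" for s n
  proof (rule poly_curve_eq[OF _ _ infinite_naturals, where t = s
        and \<gamma> = "\<lambda>s. scalar_power x (s + of_nat n)"
        and \<delta> = "\<lambda>s. scalar_power x s \<otimes> scalar_power x (of_nat n)"])
    show "poly_curve scale UNIV (\<lambda>s. scalar_power x (s + of_nat n))"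
      using poly_curve_reparam[OF subspace_UNIV poly_curve_scalar_power, of x "of_nat n" 1] by (simp add: add.commute)
    show "poly_curve scale UNIV (\<lambda>s. scalar_power x s \<otimes> scalar_power x (of_nat n))"
      by (intro poly_curve_mult poly_curve_scalar_power poly_curve_const) auto
    fix s :: 'k assume "s \<in> range of_nat"
    then obtain m where "s = of_nat m" by blast
    then show "scalar_power x (s + of_nat n) = scalar_power x s \<otimes> scalar_power x (of_nat n)"
      by (simp add: scalar_power_of_nat nat_pow_mult flip: of_nat_add)
  qed
  show ?thesis
  proof (rule poly_curve_eq[OF _ _ infinite_naturals, where t = t
        and \<gamma> = "\<lambda>t. scalar_power x (s + t)" and \<delta> = "\<lambda>t. scalar_power x s \<otimes> scalar_power x t"])
    show "poly_curve scale UNIV (\<lambda>t. scalar_power x (s + t))"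
      using poly_curve_reparam[OF subspace_UNIV poly_curve_scalar_power, of x s 1] by simp
    show "poly_curve scale UNIV (\<lambda>t. scalar_power x s \<otimes> scalar_power x t)"
      by (intro poly_curve_mult poly_curve_scalar_power poly_curve_const) auto
  qed (use nat in auto)
qed

lemma scalar_power_scalar_power: "scalar_power (scalar_power x s) t = scalar_power x (s * t)"
proof -
  have nat: "scalar_power (scalar_power x s) (of_nat n) = scalar_power x (s * of_nat n)" for s n
  proof (rule poly_curve_eq[OF _ _ infinite_naturals, where t = s
        and \<gamma> = "\<lambda>s. scalar_power (scalar_power x s) (of_nat n)"
        and \<delta> = "\<lambda>s. scalar_power x (s * of_nat n)"])
    show "poly_curve scale UNIV (\<lambda>s. scalar_power (scalar_power x s) (of_nat n))"
      by (intro poly_curve_scalar_power_base poly_curve_scalar_power)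
    show "poly_curve scale UNIV (\<lambda>s. scalar_power x (s * of_nat n))"
      using poly_curve_reparam[OF subspace_UNIV poly_curve_scalar_power, of x 0 "of_nat n"] by (simp add: mult.commute)
    fix s :: 'k assume "s \<in> range of_nat"
    then obtain m where "s = of_nat m" by blast
    then show "scalar_power (scalar_power x s) (of_nat n) = scalar_power x (s * of_nat n)"
      by (simp add: scalar_power_of_nat nat_pow_pow flip: of_nat_mult)
  qed
  show ?thesis
  proof (rule poly_curve_eq[OF _ _ infinite_naturals, where t = t
        and \<gamma> = "scalar_power (scalar_power x s)" and \<delta> = "\<lambda>t. scalar_power x (s * t)"])
    show "poly_curve scale UNIV (scalar_power (scalar_power x s))" by (rule poly_curve_scalar_power)
    show "poly_curve scale UNIV (\<lambda>t. scalar_power x (s * t))"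
      using poly_curve_reparam[OF subspace_UNIV poly_curve_scalar_power, of x 0 s] by simp
  qed (use nat in auto)
qed

section \<open>Exponential and logarithm\<close>

text \<open>
  The polynomial \<open>\<epsilon>\<^sup>p (t/\<epsilon> gchoose p)\<close>, written so that it makes sense at \<open>\<epsilon> = 0\<close>.
\<close>

definition homogenized_binomial :: "nat \<Rightarrow> 'k \<Rightarrow> 'k \<Rightarrow> 'k" where
  "homogenized_binomial p t \<epsilon> = (\<Prod>i<p. t - of_nat i * \<epsilon>) / fact p"

lemma homogenized_binomial_eq:
  assumes "\<epsilon> \<noteq> 0"
  shows "homogenized_binomial p t \<epsilon> = \<epsilon> ^ p * ((t / \<epsilon>) gchoose p)"
proof -
  have "(\<Prod>i<p. t - of_nat i * \<epsilon>) = (\<Prod>i<p. \<epsilon> * (t / \<epsilon> - of_nat i))"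
    using assms by (intro prod.cong) (auto simp: field_simps)
  then show ?thesis
    by (simp add: homogenized_binomial_def gbinomial_prod_rev prod.distrib atLeast0LessThan)
qed

text \<open>
  The expression \<open>(\<epsilon> y)\<^bsup>t/\<epsilon>\<^esup>\<close> as a polynomial in \<open>\<epsilon>\<close>. The factor \<open>\<epsilon>\<^sup>m\<close> from the component of degree \<open>m\<close> is
  split as \<open>\<epsilon>\<^bsup>m-p\<^esup> \<epsilon>\<^sup>p\<close>, the second part cancelling the denominators of \<open>t/\<epsilon> gchoose p\<close>. Truncated
  subtraction does no harm, as the components with \<open>m < p\<close> vanish.
\<close>

definition rescaled_power :: "'k \<Rightarrow> 'k \<Rightarrow> 'm \<Rightarrow> 'm" where
  "rescaled_power \<epsilon> t y = (\<Sum>p\<le>k. \<Sum>m\<le>k.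
    scale (\<epsilon> ^ (m - p) * homogenized_binomial p t \<epsilon>) (psi_component scale G p m y))"

lemma rescaled_power_eq:
  assumes "\<epsilon> \<noteq> 0"
  shows "rescaled_power \<epsilon> t y = scalar_power (scale \<epsilon> y) (t / \<epsilon>)"
  unfolding rescaled_power_def scalar_power_def
proof (rule sum.cong[OF refl])
  fix p
  have "scale (\<epsilon> ^ (m - p) * homogenized_binomial p t \<epsilon>) (psi_component scale G p m y)
      = scale ((t / \<epsilon>) gchoose p) (psi_component scale G p m (scale \<epsilon> y))" for m
  proof (cases "m < p")
    case False
    then have "\<epsilon> ^ (m - p) * \<epsilon> ^ p = \<epsilon> ^ m" by (simp flip: power_add)
    then have "\<epsilon> ^ (m - p) * homogenized_binomial p t \<epsilon> = ((t / \<epsilon>) gchoose p) * \<epsilon> ^ m"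
      by (simp add: homogenized_binomial_eq[OF assms])
    then show ?thesis
      by (simp add: endo.homogeneous_map_scaling[OF psi_component_homogeneous])
  qed (simp add: psi_component_below)
  then show "(\<Sum>m\<le>k. scale (\<epsilon> ^ (m - p) * homogenized_binomial p t \<epsilon>) (psi_component scale G p m y))
      = scale ((t / \<epsilon>) gchoose p) (psi scale G p (scale \<epsilon> y))"
    by (simp add: psi_eq_sum_components scale_sum_right)
qed

lemma poly_curve_rescaled_power:
  assumes "poly_curve scale UNIV \<gamma>"
  shows "poly_curve scale UNIV (\<lambda>\<epsilon>. rescaled_power \<epsilon> t (\<gamma> \<epsilon>))"
proof -
  have "poly_curve scale UNIV (\<lambda>\<epsilon>. scale (\<epsilon> ^ (m - p) * homogenized_binomial p t \<epsilon>)
      (psi_component scale G p m (\<gamma> \<epsilon>)))" for p m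
  proof (rule poly_curve_scale[where f = "\<lambda>\<epsilon>. \<epsilon> ^ (m - p) * homogenized_binomial p t \<epsilon>"])
    have "polynomial_map scale scale UNIV (psi_component scale G p m)"
      using endo.polynomial_map_le_homogeneous[OF psi_component_homogeneous order_refl]
      unfolding polynomial_map_def by blast
    then show "poly_curve scale UNIV (\<lambda>\<epsilon>. psi_component scale G p m (\<gamma> \<epsilon>))"
      using assms by (intro endo.poly_curve_compose_polynomial_map) auto
    show "\<epsilon> ^ (m - p) * homogenized_binomial p t \<epsilon>
        = poly (monom 1 (m - p) * smult (1 / fact p) (\<Prod>i<p. [:t, - of_nat i:])) \<epsilon>" for \<epsilon>
      by (simp add: homogenized_binomial_def poly_prod poly_monom mult.commute)
  qed auto
  then show ?thesis unfolding rescaled_power_def by (intro poly_curve_sum) auto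
qed

definition exponential :: "'m \<Rightarrow> 'm" where
  "exponential y = (\<Sum>p\<le>k. scale (1 / fact p) (psi_component scale G p p y))"

text \<open>
  Only the terms with \<open>m = p\<close> survive at \<open>\<epsilon> = 0\<close>, and there the homogenized binomial is \<open>t\<^sup>p/p!\<close>.
\<close>

lemma rescaled_power_0: "rescaled_power 0 t y = exponential (scale t y)"
  unfolding rescaled_power_def exponential_def
proof (rule sum.cong[OF refl])
  fix p assume "p \<in> {..k}"
  have "(\<Sum>m\<le>k. scale (0 ^ (m - p) * homogenized_binomial p t 0) (psi_component scale G p m y))
      = (\<Sum>m\<le>k. if m = p then scale (homogenized_binomial p t 0) (psi_component scale G p p y) else 0)"
  proof (rule sum.cong[OF refl])
    fix m
    show "scale (0 ^ (m - p) * homogenized_binomial p t 0) (psi_component scale G p m y)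
      = (if m = p then scale (homogenized_binomial p t 0) (psi_component scale G p p y) else 0)"
      by (cases m p rule: linorder_cases) (simp_all add: psi_component_below)
  qed
  also have "\<dots> = scale (t ^ p / fact p) (psi_component scale G p p y)"
    using \<open>p \<in> {..k}\<close> by (simp add: homogenized_binomial_def)
  also have "\<dots> = scale (1 / fact p) (psi_component scale G p p (scale t y))"
    by (simp add: endo.homogeneous_map_scaling[OF psi_component_homogeneous])
  finally show "(\<Sum>m\<le>k. scale (0 ^ (m - p) * homogenized_binomial p t 0) (psi_component scale G p m y))
      = scale (1 / fact p) (psi_component scale G p p (scale t y))" .
qed

lemma infinite_nonzero: "infinite (UNIV - {0 :: 'k})"
  using infinite_field by simp

lemma exponential_add: "exponential (scale (s + t) y) = exponential (scale s y) \<otimes> exponential (scale t y)"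
proof -
  have "rescaled_power 0 (s + t) y = rescaled_power 0 s y \<otimes> rescaled_power 0 t y"
  proof (rule poly_curve_eq[OF _ _ infinite_nonzero, where t = 0
        and \<gamma> = "\<lambda>\<epsilon>. rescaled_power \<epsilon> (s + t) y"
        and \<delta> = "\<lambda>\<epsilon>. rescaled_power \<epsilon> s y \<otimes> rescaled_power \<epsilon> t y"])
    show "poly_curve scale UNIV (\<lambda>\<epsilon>. rescaled_power \<epsilon> (s + t) y)"
      by (intro poly_curve_rescaled_power poly_curve_const) auto
    show "poly_curve scale UNIV (\<lambda>\<epsilon>. rescaled_power \<epsilon> s y \<otimes> rescaled_power \<epsilon> t y)"
      by (intro poly_curve_mult poly_curve_rescaled_power poly_curve_const) auto
    show "rescaled_power \<epsilon> (s + t) y = rescaled_power \<epsilon> s y \<otimes> rescaled_power \<epsilon> t y"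
      if "\<epsilon> \<in> UNIV - {0}" for \<epsilon>
      using that by (simp add: rescaled_power_eq add_divide_distrib scalar_power_add)
  qed
  then show ?thesis by (simp add: rescaled_power_0)
qed

lemma exponential_0: "exponential 0 = 0"
proof -
  have "exponential 0 = exponential 0 \<otimes> exponential 0"
    using exponential_add[of 0 0 0] by simp
  then have "exponential 0 = \<one>" using l_cancel_one' in_carrier by blast
  then show ?thesis by (simp add: one_eq)
qed

lemma exponential_int: "exponential (scale (of_int n) X) = exponential X [^] n"
proof -
  have nat: "exponential (scale (of_nat m) X) = exponential X [^] m" for m :: nat
  proof (induction m)
    case (Suc m)
    have "exponential (scale (of_nat (Suc m)) X) = exponential (scale (of_nat m) X) \<otimes> exponential X"
      using exponential_add[of "of_nat m" 1 X] by (simp add: add.commute)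
    with Suc show ?case by simp
  qed (simp add: exponential_0 one_eq)
  show ?thesis
  proof (cases n rule: int_cases2)
    case (nonneg m)
    then show ?thesis using nat by (simp add: int_pow_int)
  next
    case (nonpos m)
    have "exponential (scale (- of_nat m) X) \<otimes> exponential (scale (of_nat m) X) = \<one>"
      using exponential_add[of "- of_nat m" "of_nat m" X] by (simp add: exponential_0 one_eq)
    then have "inv (exponential (scale (of_nat m) X)) = exponential (scale (- of_nat m) X)"
      by (intro inv_equality) auto
    with nonpos show ?thesis by (simp add: int_pow_neg int_pow_int nat)
  qed
qed

definition logarithm :: "'m \<Rightarrow> 'm" where
  "logarithm x = (\<Sum>p=1..k. scale ((-1) ^ (p - 1) / of_nat p) (psi scale G p x))"

text \<open>
  The difference quotient \<open>x\<^sup>\<epsilon>/\<epsilon>\<close>, extended polynomially to \<open>\<epsilon> = 0\<close>; its value there is the derivative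
  of \<open>t \<mapsto> x\<^sup>t\<close> at \<open>t = 0\<close>.
\<close>

definition secant :: "'m \<Rightarrow> 'k \<Rightarrow> 'm" where
  "secant x \<epsilon> = (\<Sum>p=1..k. scale ((\<Prod>i=1..<p. \<epsilon> - of_nat i) / fact p) (psi scale G p x))"

lemma scale_secant: "scale \<epsilon> (secant x \<epsilon>) = scalar_power x \<epsilon>"
proof -
  have "{..k} = insert 0 {1..k}" by auto
  then have "scalar_power x \<epsilon> = (\<Sum>p=1..k. scale (\<epsilon> gchoose p) (psi scale G p x))"
    by (simp add: scalar_power_def psi_0)
  also have "\<dots> = (\<Sum>p=1..k. scale (\<epsilon> * ((\<Prod>i=1..<p. \<epsilon> - of_nat i) / fact p)) (psi scale G p x))"
  proof (intro sum.cong refl arg_cong2[of _ _ _ _ scale])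
    fix p assume "p \<in> {1..k}"
    then have "{0..<p} = insert 0 {1..<p}" by auto
    then show "(\<epsilon> gchoose p) = \<epsilon> * ((\<Prod>i=1..<p. \<epsilon> - of_nat i) / fact p)"
      by (simp add: gbinomial_prod_rev)
  qed
  finally show ?thesis by (simp add: secant_def scale_sum_right)
qed

lemma secant_0: "secant x 0 = logarithm x"
  unfolding secant_def logarithm_def
proof (intro sum.cong refl arg_cong2[of _ _ _ _ scale])
  fix p assume "p \<in> {1..k}"
  then obtain q where p: "p = Suc q" by (cases p) auto
  have "(\<Prod>i=1..<Suc q. - of_nat i :: 'k) = (-1) ^ q * fact q"
    by (induction q) (auto simp: algebra_simps)
  then show "(\<Prod>i=1..<p. 0 - of_nat i) / fact p = (- 1) ^ (p - 1) / (of_nat p :: 'k)"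
    by (simp add: p fact_Suc del: prod.op_ivl_Suc of_nat_Suc)
qed

lemma poly_curve_secant: "poly_curve scale UNIV (secant x)"
proof -
  have "poly_curve scale UNIV
      (\<lambda>t. scale ((\<Prod>i=1..<p. t - of_nat i) / fact p) (psi scale G p x))" for p
    by (rule poly_curve_scale[where P = "smult (1 / fact p) (\<Prod>i=1..<p. [:- of_nat i, 1:])"])
      (simp_all add: poly_curve_const poly_prod)
  then show ?thesis unfolding secant_def[abs_def] by (intro poly_curve_sum) auto
qed

text \<open>
  For \<open>\<epsilon> \<noteq> 0\<close> the rescaled power of the secant is \<open>(x\<^sup>\<epsilon>)\<^bsup>1/\<epsilon>\<^esup> = x\<close>; the claim is the value at \<open>\<epsilon> = 0\<close>.
\<close>

lemma exponential_logarithm: "exponential (logarithm x) = x"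
proof -
  have "rescaled_power 0 1 (secant x 0) = x"
  proof (rule poly_curve_eq[OF _ _ infinite_nonzero])
    show "poly_curve scale UNIV (\<lambda>\<epsilon>. rescaled_power \<epsilon> 1 (secant x \<epsilon>))"
      by (intro poly_curve_rescaled_power poly_curve_secant)
    show "rescaled_power \<epsilon> 1 (secant x \<epsilon>) = x" if "\<epsilon> \<in> UNIV - {0}" for \<epsilon>
      using that scalar_power_of_nat[of x 1]
      by (simp add: rescaled_power_eq scale_secant scalar_power_scalar_power)
  qed (rule poly_curve_const[OF subspace_UNIV UNIV_I])
  then show ?thesis by (simp add: rescaled_power_0 secant_0)
qed

text \<open>
  The curve \<open>e(t X)\<close> agrees with \<open>e(X)\<^sup>t\<close> for natural numbers \<open>t\<close>, hence for all scalars. Dividing by \<open>t\<close>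
  and evaluating at \<open>t = 0\<close> gives the linear term of \<open>e\<close> on one side and the logarithm on the other.
\<close>

lemma logarithm_group_exponential:
  assumes "is_group_exponential scale G e"
  shows "logarithm (e X) = X"
proof -
  from assms obtain d0 where "polynomial_map_le scale scale UNIV d0 e"
    by (auto simp: is_group_exponential_def polynomial_map_def)
  \<comment> \<open>A degree bound of at least 1 ensures that the linear term occurs in the sum.\<close>
  then have "polynomial_map_le scale scale UNIV (Suc d0) e"
    by (rule endo.polynomial_map_le_mono) simp
  note comp = endo.homogeneous_component_of_polynomial_map_le[OF infinite_field this]
  define c where "c i = homogeneous_component scale scale e i X" for i
  have e_line: "e (scale t X) = (\<Sum>i\<le>Suc d0. scale (t ^ i) (c i))" for t
  proof -
    have "homogeneous_component scale scale e i (scale t X) = scale (t ^ i) (c i)" for i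
      unfolding c_def by (rule endo.homogeneous_map_scaling[OF comp(1) subspace_UNIV UNIV_I])
    then show ?thesis by (subst comp(3)) (rule sum.cong[OF refl])
  qed
  have e_power: "(\<Sum>i\<le>Suc d0. scale (t ^ i) (c i)) = scalar_power (e X) t" for t
  proof (rule poly_curve_eq[OF _ poly_curve_scalar_power infinite_naturals])
    show "poly_curve scale UNIV (\<lambda>t. \<Sum>i\<le>Suc d0. scale (t ^ i) (c i))"
      by (intro poly_curve_sum poly_curve_monom) auto
    fix t :: 'k assume "t \<in> range of_nat"
    then obtain n where t: "t = of_nat n" by blast
    have "e (scale (of_int (int n)) X) = e X [^] int n"
      using assms unfolding is_group_exponential_def by blast
    then show "(\<Sum>i\<le>Suc d0. scale (t ^ i) (c i)) = scalar_power (e X) t"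
      unfolding e_line[symmetric] t scalar_power_of_nat by (simp add: int_pow_int)
  qed
  have c0: "c 0 = 0"
  proof -
    have "c 0 = (\<Sum>i\<le>Suc d0. scale (0 ^ i) (c i))"
      unfolding sum.atMost_Suc_shift by simp
    also have "\<dots> = e X [^] (0 :: nat)" using e_power[of 0] scalar_power_of_nat[of "e X" 0] by simp
    finally show ?thesis by (simp add: one_eq)
  qed
  have "(\<Sum>i\<le>d0. scale (0 ^ i) (c (Suc i))) = secant (e X) 0"
  proof (rule poly_curve_eq[OF _ poly_curve_secant infinite_nonzero])
    show "poly_curve scale UNIV (\<lambda>t. \<Sum>i\<le>d0. scale (t ^ i) (c (Suc i)))"
      by (intro poly_curve_sum poly_curve_monom) auto
    fix t :: 'k assume t: "t \<in> UNIV - {0}"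
    have "scale t (\<Sum>i\<le>d0. scale (t ^ i) (c (Suc i))) = (\<Sum>i\<le>Suc d0. scale (t ^ i) (c i))"
      unfolding sum.atMost_Suc_shift by (simp add: c0 scale_sum_right)
    also have "\<dots> = scale t (secant (e X) t)" by (simp only: e_power scale_secant)
    finally show "(\<Sum>i\<le>d0. scale (t ^ i) (c (Suc i))) = secant (e X) t"
      using t by (simp only: scale_cancel_left) simp
  qed
  moreover have "(\<Sum>i\<le>d0. scale (0 ^ i) (c (Suc i))) = c 1"
    by (cases d0) (simp_all only: sum.atMost_Suc_shift, simp_all)
  moreover have "c 1 = X" using assms by (simp add: c_def is_group_exponential_def)
  ultimately show ?thesis by (simp add: secant_0)
qed

lemma psi_component_0_0: "psi_component scale G 0 0 = (\<lambda>_. 0)"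
  unfolding psi_component_def
  by (subst endo.homogeneous_component_eqI[OF infinite_field, where q = "\<lambda>_ _. 0" and d = 0])
    (simp_all add: endo.homogeneous_map_zero psi_0)

lemma psi_component_1_1: "psi_component scale G 1 1 = id"
proof -
  have "homogeneous_map scale scale UNIV 1 (\<lambda>x. x)"
    unfolding homogeneous_map_def multilinear_map_def
    by (intro exI[of _ hd]) (auto simp: length_Suc_conv)
  then show ?thesis
    unfolding psi_component_def
    by (subst endo.homogeneous_component_eqI[OF infinite_field,
          where q = "\<lambda>i. if i = 1 then (\<lambda>x. x) else (\<lambda>_. 0)" and d = 1])
      (auto simp: endo.homogeneous_map_zero psi_1[simplified] fun_eq_iff)
qed

lemma exponential_homogeneous_component:
  "homogeneous_component scale scale exponential = (\<lambda>p x. scale (1 / fact p) (psi_component scale G p p x))"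
proof (rule endo.homogeneous_component_eqI[OF infinite_field])
  show "homogeneous_map scale scale UNIV p (\<lambda>x. scale (1 / fact p) (psi_component scale G p p x))" for p
    by (intro endo.homogeneous_map_scale psi_component_homogeneous)
  show "(\<lambda>x. scale (1 / fact p) (psi_component scale G p p x)) = (\<lambda>_. 0)" if "p > k" for p
    using that by (simp add: psi_component_above)
qed (rule exponential_def)

lemma exponential_polynomial: "polynomial_map scale scale UNIV exponential"
proof -
  have "polynomial_map_le scale scale UNIV k (\<lambda>x. scale (1 / fact p) (psi_component scale G p p x))"
    if "p \<in> {..k}" for p
    using that by (intro endo.polynomial_map_le_homogeneous[OF
          endo.homogeneous_map_scale[OF psi_component_homogeneous]]) auto
  then have "polynomial_map_le scale scale UNIV k exponential"
    unfolding exponential_def[abs_def] by (rule endo.polynomial_map_le_sum)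
  then show ?thesis unfolding polynomial_map_def by blast
qed

lemma logarithm_polynomial: "polynomial_map scale scale UNIV logarithm"
  unfolding logarithm_def[abs_def] polynomial_map_def
  by (rule exI[of _ k], intro endo.polynomial_map_le_sum endo.polynomial_map_le_scale psi_polynomial_map_le)

lemma exponential_is_group_exponential: "is_group_exponential scale G exponential"
  unfolding is_group_exponential_def
  using exponential_polynomial exponential_int psi_component_1_1
  by (simp add: exponential_homogeneous_component id_def)

lemma group_exponential_unique:
  assumes "is_group_exponential scale G e"
  shows "e = exponential"
proof
  show "e X = exponential X" for X
    using exponential_logarithm[of "e X"] logarithm_group_exponential[OF assms, of X] by simp
qed

end

theorem mainTheorem16:
  fixes scale :: "'k::field_char_0 \<Rightarrow> 'm::ab_group_add \<Rightarrow> 'm"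
    and G :: "'m monoid"
    and k :: nat
  assumes "polynomial_group scale G k"
  shows "(\<exists>!e. is_group_exponential scale G e) \<and>
    (\<forall>e. is_group_exponential scale G e \<longrightarrow>
      bij e \<and>
      polynomial_map scale scale UNIV (inv_into UNIV e) \<and>
      (\<forall>x. e x = (\<Sum>p=1..k. scale (1 / fact p) (psi_component scale G p p x))) \<and>
      (\<forall>x. inv_into UNIV e x = (\<Sum>p=1..k. scale ((-1) ^ (p - 1) / of_nat p) (psi scale G p x))))"
proof -
  interpret polynomial_group_char_0 scale G k
    using assms by (rule polynomial_group_char_0.intro)
  note log_exp = logarithm_group_exponential[OF exponential_is_group_exponential]
  have "bij exponential"
    using log_exp exponential_logarithm by (intro o_bij[of logarithm]) (auto simp: fun_eq_iff)
  have inv: "inv_into UNIV exponential = logarithm"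
    using log_exp exponential_logarithm by (intro Hilbert_Choice.inv_equality)
  have "{..k} = insert 0 {1..k}" by auto
  then have exp: "exponential x = (\<Sum>p=1..k. scale (1 / fact p) (psi_component scale G p p x))" for x
    by (simp add: exponential_def psi_component_0_0)
  show ?thesis
  proof (intro conjI allI impI)
    show "\<exists>!e. is_group_exponential scale G e"
      using exponential_is_group_exponential group_exponential_unique by (rule ex1I)
  next
    fix e assume "is_group_exponential scale G e"
    then have e: "e = exponential" by (rule group_exponential_unique)
    show "bij e" unfolding e by (rule \<open>bij exponential\<close>)
    show "polynomial_map scale scale UNIV (inv_into UNIV e)"
      unfolding e inv by (rule logarithm_polynomial)
    show "e x = (\<Sum>p=1..k. scale (1 / fact p) (psi_component scale G p p x))" for x
      unfolding e by (rule exp)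
    show "inv_into UNIV e x = (\<Sum>p=1..k. scale ((-1) ^ (p - 1) / of_nat p) (psi scale G p x))" for x
      unfolding e inv by (rule logarithm_def)
  qed
qed

end
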